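(* Let $d\ge3$, let $\phi$ and $\phi'$ be two mollifiers, and let $\gamma>0$ be smaller than the critical parameter $\gamma_c$ associated with each of them. Let $\mu_{\gamma,\phi}$ and $\mu_{\gamma,\phi'}$ be the corresponding limiting measures, built from the same white noise. If $\phi\not\equiv\phi'$, then $\mu_{\gamma,\phi}\neq\mu_{\gamma,\phi'}$, i.e. it is not the case that $\mu_{\gamma,\phi}=\mu_{\gamma,\phi'}$ $\mathbf P$-a.s.
   Context: $\Omega=C([0,\infty);\mathbb R^d)$ carries the topology of uniform convergence on compact sets; $\mathbb P_0$ is the Wiener measure on $\Omega$ (Brownian motion in $\mathbb R^d$ started at $0$). $\dot B$ is a space-time white noise on $\mathbb R_+\times\mathbb R^d$ on a complete probability space $(\mathcal E,\mathcal F,\mathbf P)$, independent of the Wiener measure: a centered Gaussian process with $\mathbf E[\dot B(f)\dot B(g)]=\langle f,g\rangle_{L^2(\mathbb R_+\times\mathbb R^d)}$, extended by isometry to $f\in L^2(\mathbb R_+\times\mathbb R^d)$. A mollifier is a smooth, non-negative, spherically symmetric, compactly supported $\phi:\mathbb R^d\to\mathbb R$ with $\int\phi=1$; $(\phi\star\phi)(x)=\int\phi(x-y)\phi(y)dy$. For $\omega\in\Omega$, $H_{T,\phi}(\omega)=\int_0^T\int_{\mathbb R^d}\phi(\omega_s-y)\dot B(s,y)\,dy\,ds$ (jointly measurable version, continuous in $T$), and $$\mu_{\gamma,T,\phi}(d\omega)=\exp\Big(\gamma H_{T,\phi}(\omega)-\tfrac{\gamma^2}{2}T(\phi\star\phi)(0)\Big)\mathbb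 P_0(d\omega).$$ For a given $\phi$, $\gamma_c=\sup\{\gamma>0:(\mu_{\gamma,T,\phi}(\Omega))_T\text{ is uniformly integrable}\}$; for $\gamma<\gamma_c$, $\mathbf P$-a.s. $\mu_{\gamma,T,\phi}$ converges weakly as $T\to\infty$ to a random measure $\mu_{\gamma,\phi}$ on $\Omega$, and for each fixed Borel $A\subset\Omega$, $\mu_{\gamma,T,\phi}(A)\to\mu_{\gamma,\phi}(A)$ $\mathbf P$-a.s. and in $L^1(\mathbf P)$. *)

theory Defs
  imports "HOL-Probability.Probability"
begin

text \<open>A continuous function on $[0,\infty)$ is represented by its unique extension to the
  real line that is constant on $(-\infty,0]$.\<close>

typedef (overloaded) 'a cpath =
  "{\<omega> :: real \<Rightarrow> 'a::euclidean_space. continuous_on {0..} \<omega> \<and> (\<forall>t<0. \<omega> t = \<omega> 0)}"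
  morphisms path_at Abs_cpath
  by (rule exI[of _ "\<lambda>_. 0"]) simp

text \<open>The topology of uniform convergence on compact sets.\<close>

instantiation cpath :: (euclidean_space) topological_space
begin

definition open_cpath :: "'a cpath set \<Rightarrow> bool" where
  "open_cpath U \<longleftrightarrow> (\<forall>\<omega>\<in>U. \<exists>T>0. \<exists>\<epsilon>>0. \<forall>\<eta>.
     (\<forall>s\<in>{0..T}. dist (path_at \<eta> s) (path_at \<omega> s) < \<epsilon>) \<longrightarrow> \<eta> \<in> U)"

instance
proof
  show "open (UNIV :: 'a cpath set)"
    unfolding open_cpath_def by (auto intro: exI[of _ 1])
next
  fix S T :: "'a cpath set"
  assume S: "open S" and T: "open T"
  show "open (S \<inter> T)"
    unfolding open_cpath_def
  proof
    fix \<omega> assume "\<omega> \<in> S \<inter> T"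
    then obtain a \<epsilon> b \<delta> where
      a: "a > 0" "\<epsilon> > 0"
        "\<And>\<eta>. (\<forall>s\<in>{0..a}. dist (path_at \<eta> s) (path_at \<omega> s) < \<epsilon>) \<Longrightarrow> \<eta> \<in> S" and
      b: "b > 0" "\<delta> > 0"
        "\<And>\<eta>. (\<forall>s\<in>{0..b}. dist (path_at \<eta> s) (path_at \<omega> s) < \<delta>) \<Longrightarrow> \<eta> \<in> T"
      using S T unfolding open_cpath_def by (metis IntE)
    show "\<exists>T'>0. \<exists>\<epsilon>'>0. \<forall>\<eta>.
      (\<forall>s\<in>{0..T'}. dist (path_at \<eta> s) (path_at \<omega> s) < \<epsilon>') \<longrightarrow> \<eta> \<in> S \<inter> T"
      using a b
      by (intro exI[of _ "max a b"] conjI exI[of _ "min \<epsilon> \<delta>"] allI impI IntI a(3) b(3)) auto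
  qed
next
  fix K :: "'a cpath set set"
  assume "\<forall>S\<in>K. open S"
  then show "open (\<Union>K)"
    unfolding open_cpath_def by (meson Union_iff)
qed

end

definition wiener_measure :: "'a::euclidean_space cpath measure \<Rightarrow> bool" where
  "wiener_measure W \<longleftrightarrow>
     prob_space W \<and> sets W = sets borel \<and>
     (AE \<omega> in W. path_at \<omega> 0 = 0) \<and>
     (\<forall>s t. 0 \<le> s \<and> s < t \<longrightarrow>
        distributed W lborel (\<lambda>\<omega>. path_at \<omega> t - path_at \<omega> s)
          (\<lambda>x. ennreal (\<Prod>i\<in>Basis. normal_density 0 (sqrt (t - s)) (x \<bullet> i)))) \<and>
     (\<forall>t :: nat \<Rightarrow> real. 0 \<le> t 0 \<and> incseq t \<longrightarrow>
        prob_space.indep_vars W (\<lambda>_. borel)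
          (\<lambda>k \<omega>. path_at \<omega> (t (Suc k)) - path_at \<omega> (t k)) UNIV)"

definition weakly_converges ::
  "'i filter \<Rightarrow> ('i \<Rightarrow> 'a::topological_space measure) \<Rightarrow> 'a measure \<Rightarrow> bool" where
  "weakly_converges F \<nu> \<mu> \<longleftrightarrow>
     finite_measure \<mu> \<and> (\<forall>\<^sub>F i in F. finite_measure (\<nu> i)) \<and>
     (\<forall>f :: 'a \<Rightarrow> real. continuous_on UNIV f \<and> bounded (range f) \<longrightarrow>
        ((\<lambda>i. \<integral>\<omega>. f \<omega> \<partial>\<nu> i) \<longlongrightarrow> (\<integral>\<omega>. f \<omega> \<partial>\<mu>)) F)"

text \<open>The degenerate law (variance zero) counts as Gaussian.\<close>

definition centered_gaussian :: "'e measure \<Rightarrow> ('e \<Rightarrow> real) \<Rightarrow> bool" where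
  "centered_gaussian M X \<longleftrightarrow> X \<in> borel_measurable M \<and>
     ((AE e in M. X e = 0) \<or>
      (\<exists>\<sigma>>0. distributed M lborel X (\<lambda>x. ennreal (normal_density 0 \<sigma> x))))"

definition centered_gaussian_process :: "'e measure \<Rightarrow> 'i set \<Rightarrow> ('i \<Rightarrow> 'e \<Rightarrow> real) \<Rightarrow> bool" where
  "centered_gaussian_process M I X \<longleftrightarrow>
     (\<forall>J c. finite J \<and> J \<subseteq> I \<longrightarrow> centered_gaussian M (\<lambda>e. \<Sum>j\<in>J. c j * X j e))"

definition spacetime :: "(real \<times> 'a::euclidean_space) measure" where
  "spacetime = restrict_space lborel {0..} \<Otimes>\<^sub>M lborel"

definition square_integrable :: "'a measure \<Rightarrow> ('a \<Rightarrow> real) set" where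
  "square_integrable N = {f \<in> borel_measurable N. integrable N (\<lambda>x. (f x)\<^sup>2)}"

text \<open>The noise is indexed by functions rather than by $L^2$-classes; the covariance forces
  functions that agree almost everywhere to have almost surely equal images.\<close>

definition white_noise ::
  "'e measure \<Rightarrow> ((real \<times> 'a::euclidean_space \<Rightarrow> real) \<Rightarrow> 'e \<Rightarrow> real) \<Rightarrow> bool" where
  "white_noise M B \<longleftrightarrow>
     centered_gaussian_process M (square_integrable spacetime) B \<and>
     (\<forall>f\<in>square_integrable spacetime. \<forall>g\<in>square_integrable spacetime.
        (\<integral>e. B f e * B g e \<partial>M) = (\<integral>z. f z * g z \<partial>spacetime))"

primrec continuously_differentiable :: "nat \<Rightarrow> ('a::euclidean_space \<Rightarrow> real) \<Rightarrow> bool" where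
  "continuously_differentiable 0 f \<longleftrightarrow> continuous_on UNIV f"
| "continuously_differentiable (Suc k) f \<longleftrightarrow>
     (\<forall>x. f differentiable at x) \<and>
     (\<forall>i\<in>Basis. continuously_differentiable k (\<lambda>x. frechet_derivative f (at x) i))"

definition smooth :: "('a::euclidean_space \<Rightarrow> real) \<Rightarrow> bool" where
  "smooth f \<longleftrightarrow> (\<forall>k. continuously_differentiable k f)"

definition mollifier :: "('a::euclidean_space \<Rightarrow> real) \<Rightarrow> bool" where
  "mollifier \<phi> \<longleftrightarrow>
     smooth \<phi> \<and> (\<forall>x. 0 \<le> \<phi> x) \<and>
     (\<forall>x y. norm x = norm y \<longrightarrow> \<phi> x = \<phi> y) \<and>
     compact (closure {x. \<phi> x \<noteq> 0}) \<and>
     (\<integral>x. \<phi> x \<partial>lborel) = 1"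

definition convolve ::
  "('a::euclidean_space \<Rightarrow> real) \<Rightarrow> ('a \<Rightarrow> real) \<Rightarrow> 'a \<Rightarrow> real" where
  "convolve \<phi> \<psi> x = (\<integral>y. \<phi> (x - y) * \<psi> y \<partial>lborel)"

text \<open>\<open>H\<close> is a version, jointly measurable and continuous in time, of the field
  $H_T(\omega) = \int_0^T \int \phi(\omega_s - y) \dot B(s,y)\,dy\,ds$.  The independence of noise
  and path is encoded by letting them range over the two factors of a product.\<close>

definition hamiltonian_version ::
  "'e measure \<Rightarrow> ((real \<times> 'a::euclidean_space \<Rightarrow> real) \<Rightarrow> 'e \<Rightarrow> real) \<Rightarrow> ('a \<Rightarrow> real) \<Rightarrow>
   (real \<Rightarrow> 'a cpath \<Rightarrow> 'e \<Rightarrow> real) \<Rightarrow> bool" where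
  "hamiltonian_version M B \<phi> H \<longleftrightarrow>
     (\<forall>T\<ge>0. \<forall>\<omega>. AE e in M.
        H T \<omega> e = B (\<lambda>(s, y). indicator {0..T} s * \<phi> (path_at \<omega> s - y)) e) \<and>
     (\<lambda>(T, \<omega>, e). H T \<omega> e) \<in> borel_measurable (restrict_space borel {0..} \<Otimes>\<^sub>M borel \<Otimes>\<^sub>M M) \<and>
     (\<forall>\<omega>. \<forall>e\<in>space M. continuous_on {0..} (\<lambda>T. H T \<omega> e))"

definition gmc ::
  "'a::euclidean_space cpath measure \<Rightarrow> ('a \<Rightarrow> real) \<Rightarrow> (real \<Rightarrow> 'a cpath \<Rightarrow> 'e \<Rightarrow> real) \<Rightarrow>
   real \<Rightarrow> real \<Rightarrow> 'e \<Rightarrow> 'a cpath measure" where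
  "gmc W \<phi> H \<gamma> T e =
     density W (\<lambda>\<omega>. ennreal (exp (\<gamma> * H T \<omega> e - \<gamma>\<^sup>2 / 2 * T * convolve \<phi> \<phi> 0)))"

definition uniformly_integrable :: "'e measure \<Rightarrow> 'i set \<Rightarrow> ('i \<Rightarrow> 'e \<Rightarrow> real) \<Rightarrow> bool" where
  "uniformly_integrable M I X \<longleftrightarrow>
     (\<forall>i\<in>I. integrable M (X i)) \<and>
     (\<forall>\<epsilon>>0. \<exists>K. \<forall>i\<in>I. (\<integral>e. \<bar>X i e\<bar> * indicator {e. \<bar>X i e\<bar> > K} e \<partial>M) \<le> \<epsilon>)"

text \<open>\<open>measure\<close> gives the value 0 to an infinite total mass, which for each fixed \<open>T\<close> occurs only
  on a null event.\<close>

definition critical_parameter ::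
  "'e measure \<Rightarrow> 'a::euclidean_space cpath measure \<Rightarrow> ('a \<Rightarrow> real) \<Rightarrow>
   (real \<Rightarrow> 'a cpath \<Rightarrow> 'e \<Rightarrow> real) \<Rightarrow> ereal" where
  "critical_parameter M W \<phi> H =
     Sup (ereal ` {\<gamma>. \<gamma> > 0 \<and>
       uniformly_integrable M {0..} (\<lambda>T e. measure (gmc W \<phi> H \<gamma> T e) UNIV)})"

definition random_measure :: "'e measure \<Rightarrow> ('e \<Rightarrow> 'a::topological_space measure) \<Rightarrow> bool" where
  "random_measure M \<mu> \<longleftrightarrow>
     (\<forall>e\<in>space M. finite_measure (\<mu> e) \<and> sets (\<mu> e) = sets borel) \<and>
     (\<forall>A\<in>sets borel. (\<lambda>e. emeasure (\<mu> e) A) \<in> borel_measurable M)"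

definition gmc_limit ::
  "'e measure \<Rightarrow> 'a::euclidean_space cpath measure \<Rightarrow> ('a \<Rightarrow> real) \<Rightarrow>
   (real \<Rightarrow> 'a cpath \<Rightarrow> 'e \<Rightarrow> real) \<Rightarrow> real \<Rightarrow> ('e \<Rightarrow> 'a cpath measure) \<Rightarrow> bool" where
  "gmc_limit M W \<phi> H \<gamma> \<mu> \<longleftrightarrow>
     random_measure M \<mu> \<and>
     (AE e in M. weakly_converges at_top (\<lambda>T. gmc W \<phi> H \<gamma> T e) (\<mu> e))"

end

theory Submission
  imports Defs
begin

text \<open>Only the total masses $Z = \mu(\Omega)$ are compared, by testing them against the bounded
  function $\sin \dot B(f)$ of the noise. For the masses at time $T$, Fubini and a Gaussian computation give
  $\mathbf E[\sin(\dot B(f)) Z_T] = e^{-\|f\|^2/2} \int \sin(\gamma F_T(\omega))\, \mathbb P_0(d\omega)$,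
  where $F_T(\omega)$ is the inner product of $f$ with $(s, y) \mapsto 1_{[0,T]}(s) \phi(\omega_s - y)$. Uniform
  integrability carries this identity over to $Z$. Taking $f = 1_{[0,t]} \otimes g$, dividing by $t$ and letting
  $t \to 0$ recovers $\gamma \int g \phi$ from $Z$; the choice $g = \phi - \phi'$ separates $\phi$ from $\phi'$.

  The definition of $\gamma_c$ as a supremum gives uniform integrability only at some parameter
  above $\gamma$. It passes to $\gamma$ because $\mathbf E (Z_T - k)^+$ increases with the parameter.\<close>

section \<open>Gaussian integrals\<close>

text \<open>For a fixed path the normalised exponential is a Cameron-Martin density: under it
  \<open>B f\<close> is shifted by \<gamma> times the inner product of \<open>f\<close> with the
  kernel of the Hamiltonian. A function of \<open>B f\<close> thus detects the kernel. The sine is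
  bounded, so uniform integrability of the masses is enough, and it is odd with slope 1 at 0, so the
  shift survives to first order for small t. As \<open>f\<close> lives on [0, t], the tested mass is
  the same for all T \<ge> t; its prefactor depends on \<open>f\<close> alone and is common to both
  mollifiers.

  The main obstacle is monotonicity in the parameter. It compares the masses of two Gaussian fields
  with the same covariance on different probability spaces. A mass depends on the field over all
  paths at once, whereas the white noise gives access only to finite-dimensional laws. Powers of a
  mass reduce, by Fubini over several independent paths, to expectations that involve finitely many
  field values; trigonometric functionals are the class in which these expectations are determined
  by characteristic functions.\<close>

lemma std_normal_cos_sin:
  shows "(\<integral>x. std_normal_density x * cos (t * x) \<partial>lborel) = exp (- t\<^sup>2 / 2)"
    and "(\<integral>x. std_normal_density x * sin (t * x) \<partial>lborel) = 0"
proof -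
  have i: "integrable lborel (\<lambda>x. complex_of_real (std_normal_density x) * cis (t * x))"
    by (rule Bochner_Integration.integrable_bound[OF integrable_normal_density[of 1 0]])
      (auto simp: norm_mult normal_density_nonneg cis_conv_exp)
  have "(\<integral>x. complex_of_real (std_normal_density x) * cis (t * x) \<partial>lborel)
      = char std_normal_distribution t"
    unfolding char_def
    by (subst integral_density) (auto simp: normal_density_nonneg scaleR_conv_of_real cis_conv_exp)
  also have "\<dots> = complex_of_real (exp (- t\<^sup>2 / 2))"
    by (simp add: char_std_normal_distribution)
  finally have e: "(\<integral>x. complex_of_real (std_normal_density x) * cis (t * x) \<partial>lborel)
      = complex_of_real (exp (- t\<^sup>2 / 2))" .
  show "(\<integral>x. std_normal_density x * cos (t * x) \<partial>lborel) = exp (- t\<^sup>2 / 2)"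
    using arg_cong[OF e, of Re] integral_Re[OF i] by simp
  show "(\<integral>x. std_normal_density x * sin (t * x) \<partial>lborel) = 0"
    using arg_cong[OF e, of Im] integral_Im[OF i] by simp
qed

lemma integrable_normal_density_bounded:
  fixes f :: "real \<Rightarrow> real"
  assumes "\<sigma> > 0" "f \<in> borel_measurable borel" "\<And>x. \<bar>f x\<bar> \<le> C"
  shows "integrable lborel (\<lambda>x. normal_density \<mu> \<sigma> x * f x)"
proof (rule Bochner_Integration.integrable_bound)
  show "integrable lborel (\<lambda>x. C * normal_density \<mu> \<sigma> x)"
    using assms by simp
  show "AE x in lborel. norm (normal_density \<mu> \<sigma> x * f x) \<le> norm (C * normal_density \<mu> \<sigma> x)"
  proof (rule AE_I2)
    fix x :: real
    have "\<bar>f x\<bar> \<le> \<bar>C\<bar>" using assms(3)[of x] by linarith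
    then show "norm (normal_density \<mu> \<sigma> x * f x) \<le> norm (C * normal_density \<mu> \<sigma> x)"
      by (simp add: abs_mult mult.commute mult_mono)
  qed
qed (use assms in measurable)

lemma normal_cos_sin:
  assumes "\<sigma> > 0"
  shows "(\<integral>x. normal_density \<mu> \<sigma> x * cos (t * x) \<partial>lborel) = exp (- t\<^sup>2 * \<sigma>\<^sup>2 / 2) * cos (t * \<mu>)"
    and "(\<integral>x. normal_density \<mu> \<sigma> x * sin (t * x) \<partial>lborel) = exp (- t\<^sup>2 * \<sigma>\<^sup>2 / 2) * sin (t * \<mu>)"
proof -
  have d: "normal_density \<mu> \<sigma> (\<mu> + \<sigma> * x) = std_normal_density x / \<sigma>" for x
    using assms by (simp add: normal_density_def real_sqrt_mult power_mult_distrib field_simps)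
  have i: "integrable lborel (\<lambda>x. std_normal_density x * cos (t * \<sigma> * x))"
    "integrable lborel (\<lambda>x. std_normal_density x * sin (t * \<sigma> * x))"
    by (rule integrable_normal_density_bounded[where C = 1]; simp)+
  have "(\<integral>x. normal_density \<mu> \<sigma> x * cos (t * x) \<partial>lborel)
      = \<sigma> * (\<integral>x. normal_density \<mu> \<sigma> (\<mu> + \<sigma> * x) * cos (t * (\<mu> + \<sigma> * x)) \<partial>lborel)"
    using assms by (subst lborel_integral_real_affine[where c = \<sigma> and t = \<mu>]) auto
  also have "\<dots> = \<sigma> * (\<integral>x. (cos (t * \<mu>) / \<sigma>) * (std_normal_density x * cos (t * \<sigma> * x))
      - (sin (t * \<mu>) / \<sigma>) * (std_normal_density x * sin (t * \<sigma> * x)) \<partial>lborel)"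
    unfolding d by (intro arg_cong[where f = "\<lambda>x. \<sigma> * x"] Bochner_Integration.integral_cong)
      (auto simp: cos_add algebra_simps diff_divide_distrib add_divide_distrib)
  also have "\<dots> = exp (- t\<^sup>2 * \<sigma>\<^sup>2 / 2) * cos (t * \<mu>)"
    using i assms by (simp add: std_normal_cos_sin power_mult_distrib)
  finally show "(\<integral>x. normal_density \<mu> \<sigma> x * cos (t * x) \<partial>lborel)
    = exp (- t\<^sup>2 * \<sigma>\<^sup>2 / 2) * cos (t * \<mu>)" .
  have "(\<integral>x. normal_density \<mu> \<sigma> x * sin (t * x) \<partial>lborel)
      = \<sigma> * (\<integral>x. normal_density \<mu> \<sigma> (\<mu> + \<sigma> * x) * sin (t * (\<mu> + \<sigma> * x)) \<partial>lborel)"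
    using assms by (subst lborel_integral_real_affine[where c = \<sigma> and t = \<mu>]) auto
  also have "\<dots> = \<sigma> * (\<integral>x. (sin (t * \<mu>) / \<sigma>) * (std_normal_density x * cos (t * \<sigma> * x))
      + (cos (t * \<mu>) / \<sigma>) * (std_normal_density x * sin (t * \<sigma> * x)) \<partial>lborel)"
    unfolding d by (intro arg_cong[where f = "\<lambda>x. \<sigma> * x"] Bochner_Integration.integral_cong)
      (auto simp: sin_add algebra_simps diff_divide_distrib add_divide_distrib)
  also have "\<dots> = exp (- t\<^sup>2 * \<sigma>\<^sup>2 / 2) * sin (t * \<mu>)"
    using i assms by (simp add: std_normal_cos_sin power_mult_distrib)
  finally show "(\<integral>x. normal_density \<mu> \<sigma> x * sin (t * x) \<partial>lborel)
    = exp (- t\<^sup>2 * \<sigma>\<^sup>2 / 2) * sin (t * \<mu>)" .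
qed

text \<open>Completing the square: the weight \<open>exp (a * x)\<close> moves the mean of the
  normal law from 0 to \<open>a * \<sigma>\<^sup>2\<close>. This is the Cameron-Martin formula in
  dimension one.\<close>

lemma exp_times_normal_density:
  assumes "\<sigma> > 0"
  shows "normal_density 0 \<sigma> x * exp (a * x) = exp (a\<^sup>2 * \<sigma>\<^sup>2 / 2) * normal_density (a * \<sigma>\<^sup>2) \<sigma> x"
proof -
  have "- x\<^sup>2 / (2 * \<sigma>\<^sup>2) + a * x = a\<^sup>2 * \<sigma>\<^sup>2 / 2 + - (x - a * \<sigma>\<^sup>2)\<^sup>2 / (2 * \<sigma>\<^sup>2)"
    using assms by (simp add: field_simps power2_eq_square)
  then have "exp (- x\<^sup>2 / (2 * \<sigma>\<^sup>2)) * exp (a * x)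
      = exp (a\<^sup>2 * \<sigma>\<^sup>2 / 2) * exp (- (x - a * \<sigma>\<^sup>2)\<^sup>2 / (2 * \<sigma>\<^sup>2))"
    by (simp only: exp_add[symmetric])
  then show ?thesis
    by (simp add: normal_density_def)
qed

lemma distributed_normal_tilt:
  fixes f :: "real \<Rightarrow> real"
  assumes "\<sigma> > 0" "distributed M lborel X (\<lambda>x. ennreal (normal_density 0 \<sigma> x))"
    and f: "f \<in> borel_measurable borel" "\<And>x. \<bar>f x\<bar> \<le> C"
  shows "integrable M (\<lambda>e. exp (a * X e) * f (X e))"
    and "(\<integral>e. exp (a * X e) * f (X e) \<partial>M)
      = exp (a\<^sup>2 * \<sigma>\<^sup>2 / 2) * (\<integral>x. normal_density (a * \<sigma>\<^sup>2) \<sigma> x * f x \<partial>lborel)"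
proof -
  have m: "(\<lambda>x. exp (a * x) * f x) \<in> borel_measurable lborel"
    using f by measurable
  have e: "(\<lambda>x. normal_density 0 \<sigma> x * (exp (a * x) * f x))
      = (\<lambda>x. exp (a\<^sup>2 * \<sigma>\<^sup>2 / 2) * (normal_density (a * \<sigma>\<^sup>2) \<sigma> x * f x))"
    using exp_times_normal_density[OF assms(1)] by (auto simp: fun_eq_iff mult.assoc[symmetric])
  show "integrable M (\<lambda>e. exp (a * X e) * f (X e))"
    using distributed_integrable[OF assms(2) m]
      integrable_normal_density_bounded[OF assms(1) f, of "a * \<sigma>\<^sup>2"] unfolding e by simp
  show "(\<integral>e. exp (a * X e) * f (X e) \<partial>M)
      = exp (a\<^sup>2 * \<sigma>\<^sup>2 / 2) * (\<integral>x. normal_density (a * \<sigma>\<^sup>2) \<sigma> x * f x \<partial>lborel)"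
    using distributed_integral[OF assms(2) m] unfolding e by simp
qed

text \<open>The second moment \<open>v\<close> replaces the standard deviation as parameter, so that
  the degenerate law is covered by the same formulas. In the mixed integrals the weight
  \<open>exp (a * X e)\<close> moves the mean to \<open>a * v\<close>; the characteristic function
  of the shifted law then contributes the damping \<open>exp (- t\<^sup>2 * v / 2)\<close> and the
  phase \<open>a * t * v\<close>.\<close>

lemma centered_gaussian_integrals:
  assumes "prob_space M" "centered_gaussian M X"
  defines "v \<equiv> (\<integral>e. (X e)\<^sup>2 \<partial>M)"
  shows centered_gaussian_integrable_square: "integrable M (\<lambda>e. (X e)\<^sup>2)"
    and centered_gaussian_integrable_exp: "integrable M (\<lambda>e. exp (a * X e))"
    and centered_gaussian_exp: "(\<integral>e. exp (a * X e) \<partial>M) = exp (a\<^sup>2 * v / 2)"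
    and centered_gaussian_exp_cos:
      "(\<integral>e. exp (a * X e) * cos (t * X e) \<partial>M) = exp ((a\<^sup>2 - t\<^sup>2) * v / 2) * cos (a * t * v)"
    and centered_gaussian_exp_sin:
      "(\<integral>e. exp (a * X e) * sin (t * X e) \<partial>M) = exp ((a\<^sup>2 - t\<^sup>2) * v / 2) * sin (a * t * v)"
proof -
  interpret prob_space M by fact
  have [measurable]: "X \<in> borel_measurable M" using assms(2) by (simp add: centered_gaussian_def)
  consider (zero) "AE e in M. X e = 0"
    | (normal) \<sigma> where "\<sigma> > 0" "distributed M lborel X (\<lambda>x. ennreal (normal_density 0 \<sigma> x))"
    using assms(2) by (auto simp: centered_gaussian_def)
  then have "integrable M (\<lambda>e. (X e)\<^sup>2) \<and> integrable M (\<lambda>e. exp (a * X e)) \<and>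
    (\<integral>e. exp (a * X e) \<partial>M) = exp (a\<^sup>2 * v / 2) \<and>
    (\<integral>e. exp (a * X e) * cos (t * X e) \<partial>M) = exp ((a\<^sup>2 - t\<^sup>2) * v / 2) * cos (a * t * v) \<and>
    (\<integral>e. exp (a * X e) * sin (t * X e) \<partial>M) = exp ((a\<^sup>2 - t\<^sup>2) * v / 2) * sin (a * t * v)"
  proof cases
    case zero
    \<comment> \<open>Integrating a Borel function of an almost surely vanishing variable evaluates
      the function at 0.\<close>
    have c: "integrable M (\<lambda>e. g (X e)) \<and> (\<integral>e. g (X e) \<partial>M) = g 0"
      if [measurable]: "g \<in> borel_measurable borel" for g :: "real \<Rightarrow> real"
    proof -
      have "AE e in M. g (X e) = g 0" using zero by auto
      then have "integrable M (\<lambda>e. g (X e)) \<longleftrightarrow> integrable M (\<lambda>e. g 0)"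
        "(\<integral>e. g (X e) \<partial>M) = (\<integral>e. g 0 \<partial>M)"
        by (intro integrable_cong_AE integral_cong_AE; simp)+
      then show ?thesis by (simp add: prob_space)
    qed
    have "v = 0" using c[of "\<lambda>x. x\<^sup>2"] by (simp add: v_def)
    then show ?thesis
      using c[of "\<lambda>x. x\<^sup>2"] c[of "\<lambda>x. exp (a * x)"] c[of "\<lambda>x. exp (a * x) * cos (t * x)"]
        c[of "\<lambda>x. exp (a * x) * sin (t * x)"] by simp
  next
    case normal
    have d: "integrable lborel (\<lambda>x. normal_density 0 \<sigma> x * x\<^sup>2)"
      "(\<integral>x. normal_density 0 \<sigma> x * x\<^sup>2 \<partial>lborel) = \<sigma>\<^sup>2"
      using integrable_normal_moment[OF normal(1), of 0 2]
        integral_normal_moment_even[OF normal(1), of 0 1] by (simp_all add: power2_eq_square)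
    have s: "integrable M (\<lambda>e. (X e)\<^sup>2)" "v = \<sigma>\<^sup>2"
      using distributed_integrable[OF normal(2), of "\<lambda>x. x\<^sup>2"]
        distributed_integral[OF normal(2), of "\<lambda>x. x\<^sup>2"] d by (simp_all add: v_def)
    have sub: "(a\<^sup>2 - t\<^sup>2) * v / 2 = a\<^sup>2 * \<sigma>\<^sup>2 / 2 + - t\<^sup>2 * \<sigma>\<^sup>2 / 2"
      by (simp add: s(2) field_simps)
    note tilt = distributed_normal_tilt[OF normal, where C = 1 and a = a]
    show ?thesis
      using s tilt[of "\<lambda>_. 1"] tilt(2)[of "\<lambda>x. cos (t * x)"] tilt(2)[of "\<lambda>x. sin (t * x)"]
      unfolding sub exp_add normal_cos_sin[OF normal(1)]
      by (auto simp: mult_ac integral_normal_density[OF normal(1)])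
  qed
  then show "integrable M (\<lambda>e. (X e)\<^sup>2)" "integrable M (\<lambda>e. exp (a * X e))"
    "(\<integral>e. exp (a * X e) \<partial>M) = exp (a\<^sup>2 * v / 2)"
    "(\<integral>e. exp (a * X e) * cos (t * X e) \<partial>M) = exp ((a\<^sup>2 - t\<^sup>2) * v / 2) * cos (a * t * v)"
    "(\<integral>e. exp (a * X e) * sin (t * X e) \<partial>M) = exp ((a\<^sup>2 - t\<^sup>2) * v / 2) * sin (a * t * v)"
    by blast+
qed

section \<open>Approximation of the exponential by polynomials in a sine\<close>

lemma arcsin_sin_eq:
  assumes "\<bar>y\<bar> \<le> pi / 2" shows "arcsin (sin y) = (y::real)"
  using assms by (intro arcsin_sin) auto

lemma abs_arcsin_sin_le: "\<bar>arcsin (sin y)\<bar> \<le> \<bar>y::real\<bar>"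
proof (cases "\<bar>y\<bar> \<le> pi / 2")
  case True
  then show ?thesis by (simp add: arcsin_sin_eq)
next
  case False
  then show ?thesis using arcsin_bounded[of "sin y"] by auto
qed

text \<open>The exponential is replaced by \<open>exp (a * \<tau> x)\<close> with the triangle wave
  \<open>\<tau> x = arcsin (sin (u * x)) / u\<close>, which agrees with \<open>x\<close> on a long interval; as a continuous
  function of \<open>sin (u * x)\<close> it is uniformly close to a polynomial in \<open>sin (u * x)\<close>.\<close>

lemma exp_approx_sin_polynomial:
  fixes a :: real
  assumes "0 \<le> a"
  obtains q :: "nat \<Rightarrow> real \<Rightarrow> real" and u :: "nat \<Rightarrow> real"
  where "\<And>n. real_polynomial_function (q n)"
    and "\<And>n x. \<bar>q n (sin (u n * x))\<bar> \<le> 2 * exp (a * \<bar>x\<bar>)"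
    and "\<And>x. (\<lambda>n. q n (sin (u n * x))) \<longlonglongrightarrow> exp (a * x)"
proof -
  \<comment> \<open>The sequence serves twice: as a frequency, whose decay lets the interval of
    agreement grow, and as the error allowed to the polynomial.\<close>
  define u :: "nat \<Rightarrow> real" where "u n = 1 / real (Suc n)" for n
  have u0: "u n > 0" for n by (simp add: u_def)
  define f where "f n s = exp (a * (arcsin s / u n))" for n s
  have "\<exists>q. real_polynomial_function q \<and> (\<forall>x\<in>{-1..1}. \<bar>f n x - q x\<bar> < u n)" for n
  proof -
    have "continuous_on {-1..1} (f n)"
      unfolding f_def using u0[of n]
      by (intro continuous_on_exp continuous_on_mult continuous_on_divide continuous_on_const
          continuous_on_arcsin') auto
    from Stone_Weierstrass_real_polynomial_function[OF _ this u0[of n]]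
    show ?thesis by (metis compact_Icc)
  qed
  then obtain q where q: "\<And>n. real_polynomial_function (q n)"
    and qf: "\<And>n x. x \<in> {-1..1} \<Longrightarrow> \<bar>f n x - q n x\<bar> < u n" by metis
  have qs: "\<bar>f n (sin y) - q n (sin y)\<bar> < u n" for n y
    by (rule qf) simp
  show ?thesis
  proof
    fix n x
    have "\<bar>arcsin (sin (u n * x)) / u n\<bar> \<le> \<bar>x\<bar>"
      using abs_arcsin_sin_le[of "u n * x"] u0[of n] by (simp add: abs_mult field_simps)
    then have "arcsin (sin (u n * x)) / u n \<le> \<bar>x\<bar>" by linarith
    then have "f n (sin (u n * x)) \<le> exp (a * \<bar>x\<bar>)"
      unfolding f_def using assms by (simp only: exp_le_cancel_iff mult_left_mono)
    \<comment> \<open>The polynomial error is at most 1, hence at most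
      \<open>exp (a * \<bar>x\<bar>)\<close>; this accounts for the factor 2 in the bound.\<close>
    moreover have "u n \<le> 1" by (simp add: u_def)
    moreover have "1 \<le> exp (a * \<bar>x\<bar>)" using assms by simp
    moreover have "0 \<le> f n (sin (u n * x))" by (simp add: f_def)
    ultimately show "\<bar>q n (sin (u n * x))\<bar> \<le> 2 * exp (a * \<bar>x\<bar>)"
      using qs[of n "u n * x"] by linarith
  next
    fix x :: real
    have "eventually (\<lambda>n. \<bar>x\<bar> \<le> real n) sequentially"
      by (rule eventually_sequentiallyI[of "nat \<lceil>\<bar>x\<bar>\<rceil>"]) linarith
    then have "eventually (\<lambda>n. norm (q n (sin (u n * x)) - exp (a * x)) \<le> u n) sequentially"
    proof eventually_elim
      case (elim n)
      have "\<bar>u n * x\<bar> \<le> 1" using elim by (simp add: u_def abs_mult field_simps)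
      then have "\<bar>u n * x\<bar> \<le> pi / 2" using pi_gt3 by linarith
      then have "f n (sin (u n * x)) = exp (a * x)"
        using u0[of n] by (simp add: f_def arcsin_sin_eq)
      then show ?case using qs[of n "u n * x"] by simp
    qed
    moreover have "u \<longlonglongrightarrow> 0"
      unfolding u_def using LIMSEQ_inverse_real_of_nat by (simp add: inverse_eq_divide)
    ultimately have "(\<lambda>n. q n (sin (u n * x)) - exp (a * x)) \<longlonglongrightarrow> 0"
      by (rule Lim_null_comparison)
    then show "(\<lambda>n. q n (sin (u n * x))) \<longlonglongrightarrow> exp (a * x)"
      by (rule LIM_zero_cancel)
  qed (rule q)
qed

section \<open>Trigonometric functionals\<close>

text \<open>These forms index the finite-dimensional laws of a field: the integrals of the cosine
  and sine of \<open>l\<close> applied to the field, over all such \<open>l\<close>, are its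
  finite-dimensional characteristic functions.\<close>

definition linear_form :: "(('i \<Rightarrow> real) \<Rightarrow> real) \<Rightarrow> bool" where
  "linear_form l \<longleftrightarrow> (\<exists>J c. finite J \<and> l = (\<lambda>x. \<Sum>i\<in>J. c i * x i))"

lemma linear_form_plus:
  assumes "linear_form l" "linear_form l'"
  shows "linear_form (\<lambda>x. r * l x + s * l' x)"
proof -
  obtain J c K d where J: "finite J" "l = (\<lambda>x. \<Sum>i\<in>J. c i * x i)"
    and K: "finite K" "l' = (\<lambda>x. \<Sum>i\<in>K. d i * x i)"
    using assms by (auto simp: linear_form_def)
  define b where "b i = r * (if i \<in> J then c i else 0) + s * (if i \<in> K then d i else 0)" for i
  have "r * l x + s * l' x = (\<Sum>i\<in>J \<union> K. b i * x i)" for x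
  proof -
    have "l x = (\<Sum>i\<in>J \<union> K. (if i \<in> J then c i else 0) * x i)"
      unfolding J(2) using J(1) K(1) by (intro sum.mono_neutral_cong_left) auto
    moreover have "l' x = (\<Sum>i\<in>J \<union> K. (if i \<in> K then d i else 0) * x i)"
      unfolding K(2) using J(1) K(1) by (intro sum.mono_neutral_cong_left) auto
    ultimately show ?thesis
      by (simp add: b_def sum_distrib_left sum.distrib distrib_right mult.assoc)
  qed
  then show ?thesis
    unfolding linear_form_def using J(1) K(1) by (intro exI[of _ "J \<union> K"] exI[of _ b]) auto
qed

lemma linear_form_single: "linear_form (\<lambda>x. u * x i)"
  unfolding linear_form_def by (rule exI[of _ "{i}"], rule exI[of _ "\<lambda>_. u"]) simp

lemma linear_form_zero: "linear_form (\<lambda>x. 0)"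
  unfolding linear_form_def by (rule exI[of _ "{}"]) simp

text \<open>Generated as a linear span only, so that expectations follow by linearity from
  characteristic functions. Closure under products, needed for powers of masses, is proved
  afterwards.\<close>

inductive trig_functional :: "(('i \<Rightarrow> real) \<Rightarrow> real) \<Rightarrow> bool" where
  cos: "linear_form l \<Longrightarrow> trig_functional (\<lambda>x. cos (l x))"
| sin: "linear_form l \<Longrightarrow> trig_functional (\<lambda>x. sin (l x))"
| scale: "trig_functional F \<Longrightarrow> trig_functional (\<lambda>x. r * F x)"
| add: "trig_functional F \<Longrightarrow> trig_functional G \<Longrightarrow> trig_functional (\<lambda>x. F x + G x)"

lemma trig_functional_const: "trig_functional (\<lambda>x. r)"
  using trig_functional.scale[OF trig_functional.cos[OF linear_form_zero], of r] by simp

lemma trig_functional_combine: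
  assumes "trig_functional F" "trig_functional G"
  shows "trig_functional (\<lambda>x. r * F x + s * G x)"
  using assms by (intro trig_functional.add trig_functional.scale)

text \<open>Product-to-sum formulas settle the generators, because sums and differences of linear
  forms are linear forms; the remaining cases are linear in the first factor.\<close>

lemma trig_functional_mult_cos_sin:
  assumes "trig_functional F" "linear_form l"
  shows "trig_functional (\<lambda>x. F x * cos (l x)) \<and> trig_functional (\<lambda>x. F x * sin (l x))"
  using assms(1)
proof induction
  case (cos l')
  have p: "linear_form (\<lambda>x. l' x + l x)" "linear_form (\<lambda>x. l' x - l x)"
    using linear_form_plus[OF cos assms(2), of 1 1] linear_form_plus[OF cos assms(2), of 1 "-1"]
    by simp_all
  have "(\<lambda>x. cos (l' x) * cos (l x)) = (\<lambda>x. 1/2 * cos (l' x - l x) + 1/2 * cos (l' x + l x))"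
    "(\<lambda>x. cos (l' x) * sin (l x)) = (\<lambda>x. 1/2 * sin (l' x + l x) + (-1/2) * sin (l' x - l x))"
    by (auto simp: fun_eq_iff cos_add cos_diff sin_add sin_diff field_simps)
  then show ?case
    using trig_functional_combine[OF trig_functional.cos[OF p(2)] trig_functional.cos[OF p(1)], of "1/2" "1/2"]
      trig_functional_combine[OF trig_functional.sin[OF p(1)] trig_functional.sin[OF p(2)], of "1/2" "-1/2"] by simp
next
  case (sin l')
  have p: "linear_form (\<lambda>x. l' x + l x)" "linear_form (\<lambda>x. l' x - l x)"
    using linear_form_plus[OF sin assms(2), of 1 1] linear_form_plus[OF sin assms(2), of 1 "-1"]
    by simp_all
  have "(\<lambda>x. sin (l' x) * cos (l x)) = (\<lambda>x. 1/2 * sin (l' x + l x) + 1/2 * sin (l' x - l x))"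
    "(\<lambda>x. sin (l' x) * sin (l x)) = (\<lambda>x. 1/2 * cos (l' x - l x) + (-1/2) * cos (l' x + l x))"
    by (auto simp: fun_eq_iff cos_add cos_diff sin_add sin_diff field_simps)
  then show ?case
    using trig_functional_combine[OF trig_functional.sin[OF p(1)] trig_functional.sin[OF p(2)], of "1/2" "1/2"]
      trig_functional_combine[OF trig_functional.cos[OF p(2)] trig_functional.cos[OF p(1)], of "1/2" "-1/2"] by simp
next
  case (scale F r)
  then show ?case by (auto simp: mult.assoc intro: trig_functional.scale)
next
  case (add F G)
  then show ?case by (auto simp: distrib_right intro: trig_functional.add)
qed

lemma trig_functional_mult:
  assumes "trig_functional F" "trig_functional G"
  shows "trig_functional (\<lambda>x. F x * G x)"
  using assms(2)
proof induction
  case (scale G r)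
  then show ?case using trig_functional.scale[of "\<lambda>x. F x * G x" r] by (simp add: mult_ac)
next
  case (add G H)
  then show ?case by (simp add: distrib_left trig_functional.add)
qed (use trig_functional_mult_cos_sin[OF assms(1)] in auto)

lemma trig_functional_prod:
  "finite A \<Longrightarrow> (\<And>a. a \<in> A \<Longrightarrow> trig_functional (F a)) \<Longrightarrow> trig_functional (\<lambda>x. \<Prod>a\<in>A. F a x)"
  by (induction rule: finite_induct) (auto intro: trig_functional_const trig_functional_mult)

lemma trig_functional_polynomial_sin:
  fixes q :: "real \<Rightarrow> real"
  assumes "real_polynomial_function q"
  shows "trig_functional (\<lambda>x. q (sin (u * x i)))"
  using assms
proof induction
  case (linear f)
  have "(\<lambda>x. f (sin (u * x i))) = (\<lambda>x. f 1 * sin (u * x i))"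
    using real_bounded_linear[of f] linear by (auto simp: mult.commute)
  then show ?case
    using trig_functional.scale[OF trig_functional.sin[OF linear_form_single[of u i]], of "f 1"]
    by simp
qed (auto intro: trig_functional_const trig_functional.add trig_functional_mult)

lemma trig_functional_bounded_measurable:
  assumes "trig_functional F" "\<And>i. K i \<in> borel_measurable M"
  shows "(\<lambda>e. F (\<lambda>i. K i e)) \<in> borel_measurable M" and "\<exists>C. \<forall>x. \<bar>F x\<bar> \<le> C"
proof -
  have [measurable]: "(\<lambda>e. l (\<lambda>i. K i e)) \<in> borel_measurable M" if "linear_form l" for l
    using that assms(2) unfolding linear_form_def by auto
  show "(\<lambda>e. F (\<lambda>i. K i e)) \<in> borel_measurable M"
    using assms(1) by induction auto
  show "\<exists>C. \<forall>x. \<bar>F x\<bar> \<le> C"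
    using assms(1)
  proof induction
    case (scale F r)
    then obtain C where "\<And>x. \<bar>F x\<bar> \<le> C" by auto
    then have "\<bar>r * F x\<bar> \<le> \<bar>r\<bar> * C" for x by (simp add: abs_mult mult_left_mono)
    then show ?case by blast
  next
    case (add F G)
    then obtain C D where "\<And>x. \<bar>F x\<bar> \<le> C" "\<And>x. \<bar>G x\<bar> \<le> D" by auto
    then have "\<bar>F x + G x\<bar> \<le> C + D" for x by (meson abs_triangle_ineq add_mono order_trans)
    then show ?case by blast
  qed (auto intro: exI[of _ 1])
qed

lemma trig_functional_integrable:
  assumes "prob_space M" "trig_functional F" "\<And>i. K i \<in> borel_measurable M"
  shows "integrable M (\<lambda>e. F (\<lambda>i. K i e))"
proof -
  interpret prob_space M by fact
  obtain C where "\<And>x. \<bar>F x\<bar> \<le> C" using trig_functional_bounded_measurable(2)[OF assms(2,3)] by auto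
  then show ?thesis
    using trig_functional_bounded_measurable(1)[OF assms(2,3)]
    by (intro integrable_const_bound[where B = C]) auto
qed

text \<open>Both sides are linear in \<open>F\<close>, all integrands being bounded, so agreement of
  the characteristic functions is enough.\<close>

lemma trig_functional_integral_eq:
  assumes "prob_space M" "prob_space N"
    and "\<And>i. K i \<in> borel_measurable M" "\<And>i. K' i \<in> borel_measurable N"
    and "\<And>l. linear_form l \<Longrightarrow> (\<integral>e. cos (l (\<lambda>i. K i e)) \<partial>M) = (\<integral>e. cos (l (\<lambda>i. K' i e)) \<partial>N)"
    and "\<And>l. linear_form l \<Longrightarrow> (\<integral>e. sin (l (\<lambda>i. K i e)) \<partial>M) = (\<integral>e. sin (l (\<lambda>i. K' i e)) \<partial>N)"
    and "trig_functional F"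
  shows "(\<integral>e. F (\<lambda>i. K i e) \<partial>M) = (\<integral>e. F (\<lambda>i. K' i e) \<partial>N)"
  using assms(7)
proof induction
  case (add F G)
  then show ?case
    using trig_functional_integrable[OF assms(1) add.hyps(1), of K, OF assms(3)]
      trig_functional_integrable[OF assms(1) add.hyps(2), of K, OF assms(3)]
      trig_functional_integrable[OF assms(2) add.hyps(1), of K', OF assms(4)]
      trig_functional_integrable[OF assms(2) add.hyps(2), of K', OF assms(4)]
    by simp
qed (simp_all add: assms(5,6))

section \<open>Exponential masses of two fields with the same covariance\<close>

lemma abs_integral_le_bound:
  fixes f :: "'w \<Rightarrow> real"
  assumes "prob_space W" "\<And>x. \<bar>f x\<bar> \<le> C"
  shows "\<bar>\<integral>x. f x \<partial>W\<bar> \<le> C"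
proof (cases "integrable W f")
  case True
  interpret prob_space W by fact
  have "\<bar>\<integral>x. f x \<partial>W\<bar> \<le> (\<integral>x. C \<partial>W)"
    using True assms(2)
    by (intro order_trans[OF integral_abs_bound] integral_mono integrable_abs) auto
  then show ?thesis by (simp add: prob_space)
next
  case False
  \<comment> \<open>The integral defaults to 0 here, and \<open>C\<close> is nonnegative because it
    bounds an absolute value at some point.\<close>
  then show ?thesis using assms(2)[of undefined] by (simp add: not_integrable_integral_eq)
qed

text \<open>Replicas: the \<open>k\<close>-th power of an integral over \<open>W\<close> is an
  integral over \<open>k\<close> independent copies of \<open>W\<close>. After Fubini the inner
  expectation involves the field at \<open>k\<close> points only.\<close>

lemma power_mass_integral:
  fixes g :: "'w \<Rightarrow> 'e \<Rightarrow> real"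
  assumes "prob_space W" "prob_space M"
    and g[measurable]: "case_prod g \<in> borel_measurable (W \<Otimes>\<^sub>M M)"
    and bound: "\<And>w e. \<bar>g w e\<bar> \<le> C"
  shows "(\<integral>e. (\<integral>w. g w e \<partial>W) ^ k \<partial>M)
    = (\<integral>x. (\<integral>e. (\<Prod>i<k. g (x i) e) \<partial>M) \<partial>(\<Pi>\<^sub>M i\<in>{..<k}. W))"
proof -
  interpret W: prob_space W by fact
  interpret M: prob_space M by fact
  interpret P: product_prob_space "\<lambda>_::nat. W" ..
  interpret F: finite_product_prob_space "\<lambda>_::nat. W" "{..<k}" by unfold_locales simp
  interpret Q: pair_prob_space "\<Pi>\<^sub>M i\<in>{..<k}. W" M ..
  have gi: "integrable W (\<lambda>w. g w e)" if "e \<in> space M" for e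
    using bound that by (intro W.integrable_const_bound[where B = C]) auto
  have gm: "(\<lambda>z. g (fst z i) (snd z)) \<in> borel_measurable ((\<Pi>\<^sub>M i\<in>{..<k}. W) \<Otimes>\<^sub>M M)" if "i < k" for i
  proof -
    have "(\<lambda>z. (fst z i, snd z)) \<in> ((\<Pi>\<^sub>M i\<in>{..<k}. W) \<Otimes>\<^sub>M M) \<rightarrow>\<^sub>M (W \<Otimes>\<^sub>M M)"
      using that by (intro measurable_Pair measurable_snd
          measurable_compose[OF measurable_fst measurable_component_singleton]) auto
    from measurable_compose[OF this g] show ?thesis by simp
  qed
  have "integrable ((\<Pi>\<^sub>M i\<in>{..<k}. W) \<Otimes>\<^sub>M M) (\<lambda>(x, e). \<Prod>i<k. g (x i) e)"
  proof (rule Q.integrable_const_bound[where B = "C ^ k"])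
    have "\<bar>\<Prod>i<k. g (x i) e\<bar> \<le> C ^ k" for x e
      using prod_mono[of "{..<k}" "\<lambda>i. \<bar>g (x i) e\<bar>" "\<lambda>_. C"] bound by (auto simp: abs_prod)
    then show "AE z in (\<Pi>\<^sub>M i\<in>{..<k}. W) \<Otimes>\<^sub>M M. norm (case z of (x, e) \<Rightarrow> \<Prod>i<k. g (x i) e) \<le> C ^ k"
      by (auto intro!: AE_I2)
    show "(\<lambda>(x, e). \<Prod>i<k. g (x i) e) \<in> borel_measurable ((\<Pi>\<^sub>M i\<in>{..<k}. W) \<Otimes>\<^sub>M M)"
      unfolding case_prod_beta using gm by (intro borel_measurable_prod) auto
  qed
  from Q.Fubini_integral[OF this]
  have "(\<integral>x. (\<integral>e. (\<Prod>i<k. g (x i) e) \<partial>M) \<partial>(\<Pi>\<^sub>M i\<in>{..<k}. W))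
    = (\<integral>e. (\<integral>x. (\<Prod>i<k. g (x i) e) \<partial>(\<Pi>\<^sub>M i\<in>{..<k}. W)) \<partial>M)" by simp
  also have "\<dots> = (\<integral>e. (\<integral>w. g w e \<partial>W) ^ k \<partial>M)"
    using gi by (intro Bochner_Integration.integral_cong refl)
      (subst P.product_integral_prod, auto)
  finally show ?thesis by simp
qed

lemma measurable_section:
  assumes "case_prod K \<in> borel_measurable (W \<Otimes>\<^sub>M M)" "space W = UNIV"
  shows "K w \<in> borel_measurable M"
  using measurable_compose_Pair1[of w W "case_prod K" M borel] assms by simp

text \<open>Method of moments. With the replicas \<open>x i\<close> fixed, the integrand of the
  \<open>k\<close>-th moment is a product of polynomials in sines, hence a trigonometric functional
  with the same expectation for both fields. As both masses stay in \<open>{-C..C}\<close>,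
  Weierstrass approximation on this interval passes from powers to \<Phi>.\<close>

lemma bounded_mass_law_eq:
  fixes K :: "'w \<Rightarrow> 'e \<Rightarrow> real" and K' :: "'w \<Rightarrow> 'f \<Rightarrow> real"
  assumes "prob_space W" "space W = UNIV" "prob_space M" "prob_space N"
    and K[measurable]: "case_prod K \<in> borel_measurable (W \<Otimes>\<^sub>M M)"
    and K'[measurable]: "case_prod K' \<in> borel_measurable (W \<Otimes>\<^sub>M N)"
    and eq: "\<And>F. trig_functional F \<Longrightarrow> (\<integral>e. F (\<lambda>w. K w e) \<partial>M) = (\<integral>e. F (\<lambda>w. K' w e) \<partial>N)"
    and q: "real_polynomial_function q" and \<Phi>: "continuous_on UNIV (\<Phi> :: real \<Rightarrow> real)"
  shows "(\<integral>e. \<Phi> (\<integral>w. q (sin (u * K w e)) \<partial>W) \<partial>M) = (\<integral>e. \<Phi> (\<integral>w. q (sin (u * K' w e)) \<partial>W) \<partial>N)"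
proof -
  interpret W: prob_space W by fact
  interpret M: prob_space M by fact
  interpret N: prob_space N by fact
  have qc: "continuous_on UNIV q"
    using q by (simp add: continuous_on_polymonial_function real_polynomial_function_eq)
  then have [measurable]: "q \<in> borel_measurable borel"
    by (rule borel_measurable_continuous_onI)
  have "bounded (q ` {-1..1})"
    using qc by (intro compact_imp_bounded compact_continuous_image continuous_on_subset[OF qc]) auto
  then obtain C where "\<forall>y\<in>q ` {-1..1}. norm y \<le> C"
    unfolding bounded_iff by blast
  then have C: "\<bar>q (sin x)\<bar> \<le> C" for x by simp
  define Y where "Y e = (\<integral>w. q (sin (u * K w e)) \<partial>W)" for e
  define Y' where "Y' e = (\<integral>w. q (sin (u * K' w e)) \<partial>W)" for e
  have [measurable]: "(\<lambda>(e, w). K w e) \<in> borel_measurable (M \<Otimes>\<^sub>M W)"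
    "(\<lambda>(e, w). K' w e) \<in> borel_measurable (N \<Otimes>\<^sub>M W)"
    using measurable_compose[OF measurable_pair_swap' K] measurable_compose[OF measurable_pair_swap' K']
    by (simp_all add: case_prod_beta)
  have YM[measurable]: "Y \<in> borel_measurable M" "Y' \<in> borel_measurable N"
    unfolding Y_def Y'_def by measurable
  have YC: "\<bar>Y e\<bar> \<le> C" and YC': "\<bar>Y' e'\<bar> \<le> C" for e e'
    unfolding Y_def Y'_def using C by (intro abs_integral_le_bound[OF assms(1)]; simp)+
  have moment: "(\<integral>e. Y e ^ k \<partial>M) = (\<integral>e. Y' e ^ k \<partial>N)" for k
  proof -
    have "(\<integral>e. (\<Prod>i<k. q (sin (u * K (x i) e))) \<partial>M) = (\<integral>e. (\<Prod>i<k. q (sin (u * K' (x i) e))) \<partial>N)" for x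
      by (rule eq[of "\<lambda>y. \<Prod>i<k. q (sin (u * y (x i)))"])
        (intro trig_functional_prod trig_functional_polynomial_sin q, simp)
    then show ?thesis
      unfolding Y_def Y'_def
      using power_mass_integral[OF assms(1,3), of "\<lambda>w e. q (sin (u * K w e))" C k]
        power_mass_integral[OF assms(1,4), of "\<lambda>w e. q (sin (u * K' w e))" C k] C
      by simp
  qed
  have [measurable]: "\<Phi> \<in> borel_measurable borel"
    using \<Phi> by (rule borel_measurable_continuous_onI)
  have int_pow: "integrable M (\<lambda>e. Y e ^ k)" "integrable N (\<lambda>e. Y' e ^ k)" for k
    using YC YC' by (auto intro!: M.integrable_const_bound[where B = "C ^ k"]
        N.integrable_const_bound[where B = "C ^ k"] AE_I2 simp: power_abs power_mono)
  have "bounded (\<Phi> ` {-C..C})"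
    by (intro compact_imp_bounded compact_continuous_image continuous_on_subset[OF \<Phi>]) auto
  then obtain D where "\<forall>y\<in>\<Phi> ` {-C..C}. norm y \<le> D"
    unfolding bounded_iff by blast
  moreover have sub: "x \<in> {-C..C}" if "\<bar>x\<bar> \<le> C" for x using that by auto
  ultimately have D: "\<bar>\<Phi> x\<bar> \<le> D" if "\<bar>x\<bar> \<le> C" for x using that by force
  have int_\<Phi>: "integrable M (\<lambda>e. \<Phi> (Y e))" "integrable N (\<lambda>e. \<Phi> (Y' e))"
    using D YC YC' by (auto intro!: M.integrable_const_bound[where B = D]
        N.integrable_const_bound[where B = D] AE_I2)
  have "\<bar>(\<integral>e. \<Phi> (Y e) \<partial>M) - (\<integral>e. \<Phi> (Y' e) \<partial>N)\<bar> \<le> \<epsilon>" if \<epsilon>: "\<epsilon> > 0" for \<epsilon>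
  proof -
    obtain r where "real_polynomial_function r" and r': "\<And>x. x \<in> {-C..C} \<Longrightarrow> \<bar>\<Phi> x - r x\<bar> < \<epsilon> / 2"
      using Stone_Weierstrass_real_polynomial_function[OF compact_Icc
          continuous_on_subset[OF \<Phi> subset_UNIV] half_gt_zero[OF \<epsilon>]] by blast
    then obtain a n where "r = (\<lambda>x. \<Sum>i\<le>n. a i * x ^ i)"
      unfolding real_polynomial_function_iff_sum by auto
    then have r: "\<bar>\<Phi> x - (\<Sum>i\<le>n. a i * x ^ i)\<bar> < \<epsilon> / 2" if "\<bar>x\<bar> \<le> C" for x
      using r'[OF sub[OF that]] by simp
    let ?r = "\<lambda>x::real. \<Sum>i\<le>n. a i * x ^ i"
    have ri: "integrable M (\<lambda>e. ?r (Y e))" "integrable N (\<lambda>e. ?r (Y' e))"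
      using int_pow by simp_all
    have "\<bar>(\<integral>e. \<Phi> (Y e) - ?r (Y e) \<partial>M)\<bar> \<le> \<epsilon> / 2"
      by (rule abs_integral_le_bound[OF assms(3)]) (rule less_imp_le[OF r[OF YC]])
    then have M: "\<bar>(\<integral>e. \<Phi> (Y e) \<partial>M) - (\<integral>e. ?r (Y e) \<partial>M)\<bar> \<le> \<epsilon> / 2"
      using int_\<Phi> ri by simp
    have "\<bar>(\<integral>e. \<Phi> (Y' e) - ?r (Y' e) \<partial>N)\<bar> \<le> \<epsilon> / 2"
      by (rule abs_integral_le_bound[OF assms(4)]) (rule less_imp_le[OF r[OF YC']])
    then have N: "\<bar>(\<integral>e. \<Phi> (Y' e) \<partial>N) - (\<integral>e. ?r (Y' e) \<partial>N)\<bar> \<le> \<epsilon> / 2"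
      using int_\<Phi> ri by simp
    have "(\<integral>e. ?r (Y e) \<partial>M) = (\<integral>e. ?r (Y' e) \<partial>N)"
      using int_pow moment by simp
    with M N show ?thesis by linarith
  qed
  then have "\<bar>(\<integral>e. \<Phi> (Y e) \<partial>M) - (\<integral>e. \<Phi> (Y' e) \<partial>N)\<bar> \<le> 0"
    by (rule field_le_epsilon) simp
  then show ?thesis by (simp add: Y_def Y'_def)
qed

text \<open>The approximants converge in L1 on the product space by dominated convergence.
  Integrating out the path does not increase the L1 distance, and neither does the 1-Lipschitz
  function \<Phi>.\<close>

lemma bounded_mass_limit:
  fixes K :: "'w \<Rightarrow> 'e \<Rightarrow> real" and p :: "nat \<Rightarrow> real \<Rightarrow> real"
  assumes "prob_space W" "prob_space M"
    and K[measurable]: "case_prod K \<in> borel_measurable (W \<Otimes>\<^sub>M M)"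
    and int: "integrable (W \<Otimes>\<^sub>M M) (\<lambda>(w, e). exp (a * \<bar>K w e\<bar>))" and a: "0 \<le> a"
    and p[measurable]: "\<And>n. p n \<in> borel_measurable borel"
    and bound: "\<And>n x. \<bar>p n x\<bar> \<le> 2 * exp (a * \<bar>x\<bar>)"
    and lim: "\<And>x. (\<lambda>n. p n x) \<longlonglongrightarrow> exp (a * x)"
    and \<Phi>: "\<And>x y. \<bar>\<Phi> x - \<Phi> y :: real\<bar> \<le> \<bar>x - y\<bar>"
  shows "(\<lambda>n. \<integral>e. \<Phi> (\<integral>w. p n (K w e) \<partial>W) \<partial>M) \<longlonglongrightarrow> (\<integral>e. \<Phi> (\<integral>w. exp (a * K w e) \<partial>W) \<partial>M)"
proof -
  interpret W: prob_space W by fact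
  interpret M: prob_space M by fact
  interpret P: pair_prob_space W M ..
  let ?P = "W \<Otimes>\<^sub>M M"
  have "continuous_on UNIV \<Phi>"
    using \<Phi> by (intro lipschitz_on_continuous_on[of 1] lipschitz_onI) (auto simp: dist_real_def)
  then have \<Phi>m[measurable]: "\<Phi> \<in> borel_measurable borel"
    by (rule borel_measurable_continuous_onI)
  have exp_le: "exp (a * x) \<le> exp (a * \<bar>x\<bar>)" for x
    using a by (simp add: mult_left_mono)
  \<comment> \<open>The constant 3 is 2 from the bound on \<open>p n\<close> plus 1 from the
    exponential itself.\<close>
  have diff: "\<bar>p n x - exp (a * x)\<bar> \<le> 3 * exp (a * \<bar>x\<bar>)" for n x
    using bound[of n x] exp_le[of x] exp_gt_zero[of "a * x"] by linarith
  have i_exp: "integrable ?P (\<lambda>(w, e). exp (a * K w e))"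
    using exp_le by (intro Bochner_Integration.integrable_bound[OF int]) (auto intro!: AE_I2)
  have i_p: "integrable ?P (\<lambda>(w, e). p n (K w e))" for n
    by (rule Bochner_Integration.integrable_bound[where f = "\<lambda>z. 2 * (case z of (w, e) \<Rightarrow> exp (a * \<bar>K w e\<bar>))"])
      (use int bound in \<open>auto intro!: AE_I2\<close>)
  have i_d: "integrable ?P (\<lambda>(w, e). \<bar>p n (K w e) - exp (a * K w e)\<bar>)" for n
    by (rule Bochner_Integration.integrable_bound[where f = "\<lambda>z. 3 * (case z of (w, e) \<Rightarrow> exp (a * \<bar>K w e\<bar>))"])
      (use int diff in \<open>auto intro!: AE_I2\<close>)
  have "(\<lambda>n. \<integral>z. (case z of (w, e) \<Rightarrow> \<bar>p n (K w e) - exp (a * K w e)\<bar>) \<partial>?P) \<longlonglongrightarrow> (\<integral>z. 0 \<partial>?P)"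
  proof (rule integral_dominated_convergence[where w = "\<lambda>z. 3 * (case z of (w, e) \<Rightarrow> exp (a * \<bar>K w e\<bar>))"])
    have "(\<lambda>n. \<bar>p n x - exp (a * x)\<bar>) \<longlonglongrightarrow> 0" for x
      using tendsto_rabs[OF LIM_zero[OF lim[of x]]] by simp
    then show "AE z in ?P. (\<lambda>n. case z of (w, e) \<Rightarrow> \<bar>p n (K w e) - exp (a * K w e)\<bar>) \<longlonglongrightarrow> 0"
      by (auto intro!: AE_I2)
    show "AE z in ?P. norm (case z of (w, e) \<Rightarrow> \<bar>p n (K w e) - exp (a * K w e)\<bar>)
      \<le> 3 * (case z of (w, e) \<Rightarrow> exp (a * \<bar>K w e\<bar>))" for n
      using diff by (auto intro!: AE_I2)
  qed (use int in auto)
  then have lim0: "(\<lambda>n. \<integral>z. (case z of (w, e) \<Rightarrow> \<bar>p n (K w e) - exp (a * K w e)\<bar>) \<partial>?P) \<longlonglongrightarrow> 0"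
    by simp
  have i\<Phi>: "integrable M (\<lambda>e. \<Phi> (Y e))" if "integrable M Y" for Y
  proof (rule Bochner_Integration.integrable_bound[where f = "\<lambda>e. \<bar>\<Phi> 0\<bar> + \<bar>Y e\<bar>"])
    have "\<bar>\<Phi> x\<bar> \<le> \<bar>\<Phi> 0\<bar> + \<bar>x\<bar>" for x using \<Phi>[of x 0] by linarith
    then show "AE e in M. norm (\<Phi> (Y e)) \<le> norm (\<bar>\<Phi> 0\<bar> + \<bar>Y e\<bar>)"
      by (auto intro!: AE_I2 simp del: abs_add_abs)
  qed (use that in auto)
  have "\<bar>(\<integral>e. \<Phi> (\<integral>w. p n (K w e) \<partial>W) \<partial>M) - (\<integral>e. \<Phi> (\<integral>w. exp (a * K w e) \<partial>W) \<partial>M)\<bar>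
    \<le> (\<integral>z. (case z of (w, e) \<Rightarrow> \<bar>p n (K w e) - exp (a * K w e)\<bar>) \<partial>?P)" for n
  proof -
    note i1 = i\<Phi>[OF P.integrable_snd[OF i_p[of n]]] and i2 = i\<Phi>[OF P.integrable_snd[OF i_exp]]
    have "\<bar>(\<integral>e. \<Phi> (\<integral>w. p n (K w e) \<partial>W) \<partial>M) - (\<integral>e. \<Phi> (\<integral>w. exp (a * K w e) \<partial>W) \<partial>M)\<bar>
      = \<bar>\<integral>e. \<Phi> (\<integral>w. p n (K w e) \<partial>W) - \<Phi> (\<integral>w. exp (a * K w e) \<partial>W) \<partial>M\<bar>"
      using i1 i2 by simp
    also have "\<dots> \<le> (\<integral>e. \<bar>\<Phi> (\<integral>w. p n (K w e) \<partial>W) - \<Phi> (\<integral>w. exp (a * K w e) \<partial>W)\<bar> \<partial>M)"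
      by (rule integral_abs_bound)
    also have "\<dots> \<le> (\<integral>e. (\<integral>w. \<bar>p n (K w e) - exp (a * K w e)\<bar> \<partial>W) \<partial>M)"
    proof (rule integral_mono_AE)
      \<comment> \<open>The difference of the two masses is the integral of the difference only
        where both sections are integrable, which is almost everywhere.\<close>
      show "AE e in M. \<bar>\<Phi> (\<integral>w. p n (K w e) \<partial>W) - \<Phi> (\<integral>w. exp (a * K w e) \<partial>W)\<bar>
        \<le> (\<integral>w. \<bar>p n (K w e) - exp (a * K w e)\<bar> \<partial>W)"
        using P.AE_integrable_snd[OF i_p[of n]] P.AE_integrable_snd[OF i_exp]
      proof eventually_elim
        case (elim e)
        have "\<bar>\<Phi> (\<integral>w. p n (K w e) \<partial>W) - \<Phi> (\<integral>w. exp (a * K w e) \<partial>W)\<bar>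
          \<le> \<bar>\<integral>w. p n (K w e) - exp (a * K w e) \<partial>W\<bar>"
          using \<Phi> elim by simp
        also have "\<dots> \<le> (\<integral>w. \<bar>p n (K w e) - exp (a * K w e)\<bar> \<partial>W)"
          by (rule integral_abs_bound)
        finally show ?case .
      qed
    qed (use i1 i2 P.integrable_snd[OF i_d[of n]] in auto)
    also have "\<dots> = (\<integral>z. (case z of (w, e) \<Rightarrow> \<bar>p n (K w e) - exp (a * K w e)\<bar>) \<partial>?P)"
      by (rule P.integral_snd[OF i_d])
    finally show ?thesis .
  qed
  then show ?thesis
    by (intro LIM_zero_cancel[OF Lim_null_comparison[OF always_eventually lim0]]) auto
qed

text \<open>Exponential masses have moments of log-normal growth, which do not determine the law; the
  masses of the bounded approximants by polynomials in a sine are determined by their moments.\<close>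

lemma exp_mass_law_eq:
  fixes K :: "'w \<Rightarrow> 'e \<Rightarrow> real" and K' :: "'w \<Rightarrow> 'f \<Rightarrow> real"
  assumes "prob_space W" "space W = UNIV" "prob_space M" "prob_space N"
    and "case_prod K \<in> borel_measurable (W \<Otimes>\<^sub>M M)" "case_prod K' \<in> borel_measurable (W \<Otimes>\<^sub>M N)"
    and "\<And>l. linear_form l \<Longrightarrow> (\<integral>e. cos (l (\<lambda>w. K w e)) \<partial>M) = (\<integral>e. cos (l (\<lambda>w. K' w e)) \<partial>N)"
    and "\<And>l. linear_form l \<Longrightarrow> (\<integral>e. sin (l (\<lambda>w. K w e)) \<partial>M) = (\<integral>e. sin (l (\<lambda>w. K' w e)) \<partial>N)"
    and "0 \<le> a"
    and "integrable (W \<Otimes>\<^sub>M M) (\<lambda>(w, e). exp (a * \<bar>K w e\<bar>))"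
    and "integrable (W \<Otimes>\<^sub>M N) (\<lambda>(w, e). exp (a * \<bar>K' w e\<bar>))"
    and \<Phi>: "\<And>x y. \<bar>\<Phi> x - \<Phi> y :: real\<bar> \<le> \<bar>x - y\<bar>"
  shows "(\<integral>e. \<Phi> (\<integral>w. exp (a * K w e) \<partial>W) \<partial>M) = (\<integral>e. \<Phi> (\<integral>w. exp (a * K' w e) \<partial>W) \<partial>N)"
proof -
  obtain q u where q: "\<And>n. real_polynomial_function (q n)"
    and qb: "\<And>n x. \<bar>q n (sin (u n * x))\<bar> \<le> 2 * exp (a * \<bar>x\<bar>)"
    and ql: "\<And>x. (\<lambda>n. q n (sin (u n * x))) \<longlonglongrightarrow> exp (a * x)"
    using exp_approx_sin_polynomial[OF \<open>0 \<le> a\<close>] by blast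
  have "continuous_on UNIV (q n)" for n
    using q by (simp add: continuous_on_polymonial_function real_polynomial_function_eq)
  then have [measurable]: "q n \<in> borel_measurable borel" for n
    by (rule borel_measurable_continuous_onI)
  have \<Phi>c: "continuous_on UNIV \<Phi>"
    using \<Phi> by (intro lipschitz_on_continuous_on[of 1] lipschitz_onI) (auto simp: dist_real_def)
  have eq: "(\<integral>e. F (\<lambda>w. K w e) \<partial>M) = (\<integral>e. F (\<lambda>w. K' w e) \<partial>N)" if "trig_functional F" for F
    by (rule trig_functional_integral_eq[OF assms(3,4)
        measurable_section[OF assms(5,2)] measurable_section[OF assms(6,2)] assms(7,8) that])
  have "(\<lambda>n. \<integral>e. \<Phi> (\<integral>w. q n (sin (u n * K w e)) \<partial>W) \<partial>M) \<longlonglongrightarrow> (\<integral>e. \<Phi> (\<integral>w. exp (a * K w e) \<partial>W) \<partial>M)"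
    using bounded_mass_limit[OF assms(1,3,5,10,9), of "\<lambda>n x. q n (sin (u n * x))"] qb ql \<Phi> by simp
  \<comment> \<open>Each term of the sequence for \<open>K\<close> equals the corresponding term for
    \<open>K'\<close>, so one sequence has both integrals as limits.\<close>
  moreover have "(\<lambda>n. \<integral>e. \<Phi> (\<integral>w. q n (sin (u n * K w e)) \<partial>W) \<partial>M) \<longlonglongrightarrow> (\<integral>e. \<Phi> (\<integral>w. exp (a * K' w e) \<partial>W) \<partial>N)"
    using bounded_mass_limit[OF assms(1,4,6,11,9), of "\<lambda>n x. q n (sin (u n * x))"] qb ql \<Phi>
      bounded_mass_law_eq[OF assms(1-6) eq q \<Phi>c] by simp
  ultimately show ?thesis by (rule LIMSEQ_unique)
qed

section \<open>Pairs of Gaussian variables\<close>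

lemma integrable_exp_abs_of_exp:
  fixes f :: "'a \<Rightarrow> real"
  assumes "integrable M (\<lambda>x. exp (a * f x))" "integrable M (\<lambda>x. exp (- a * f x))"
    and [measurable]: "f \<in> borel_measurable M"
  shows "integrable M (\<lambda>x. exp (a * \<bar>f x\<bar>))"
proof (rule Bochner_Integration.integrable_bound)
  show "integrable M (\<lambda>e. exp (a * f e) + exp (- a * f e))"
    by (intro Bochner_Integration.integrable_add assms)
  have "exp (a * \<bar>x\<bar>) \<le> exp (a * x) + exp (- a * x)" for x
    by (cases "0 \<le> x") auto
  then show "AE e in M. norm (exp (a * \<bar>f e\<bar>)) \<le> norm (exp (a * f e) + exp (- a * f e))"
    by (auto intro!: AE_I2 order_trans[OF _ abs_ge_self])
qed measurable

lemma centered_gaussian_integrable_exp_abs: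
  assumes "prob_space M" "centered_gaussian M X"
  shows "integrable M (\<lambda>e. exp (a * \<bar>X e\<bar>))"
  using assms(2)
  by (intro integrable_exp_abs_of_exp centered_gaussian_integrable_exp assms)
    (simp add: centered_gaussian_def)

lemma integrable_mult_of_squares:
  fixes f g :: "'e \<Rightarrow> real"
  assumes "integrable M (\<lambda>e. (f e)\<^sup>2)" "integrable M (\<lambda>e. (g e)\<^sup>2)"
    and "f \<in> borel_measurable M" "g \<in> borel_measurable M"
  shows "integrable M (\<lambda>e. f e * g e)"
proof (rule Bochner_Integration.integrable_bound)
  show "integrable M (\<lambda>e. (f e)\<^sup>2 + (g e)\<^sup>2)" using assms by simp
  have "\<bar>x * y\<bar> \<le> x\<^sup>2 + y\<^sup>2" for x y :: real
  proof -
    have "2 * (\<bar>x\<bar> * \<bar>y\<bar>) \<le> x\<^sup>2 + y\<^sup>2" using sum_squares_bound[of "\<bar>x\<bar>" "\<bar>y\<bar>"] by simp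
    moreover have "0 \<le> \<bar>x\<bar> * \<bar>y\<bar>" by simp
    ultimately show ?thesis unfolding abs_mult by linarith
  qed
  then show "AE e in M. norm (f e * g e) \<le> norm ((f e)\<^sup>2 + (g e)\<^sup>2)"
    by simp
qed (use assms in measurable)

lemma linear_form_const:
  assumes "linear_form l"
  shows "l (\<lambda>_. y) = l (\<lambda>_. 1) * y"
  using assms by (auto simp: linear_form_def sum_distrib_right)

text \<open>Uncorrelated jointly Gaussian variables are independent, in the form needed for the sine
  of a sum. The index type \<open>unit\<close> makes \<open>F\<close> a trigonometric functional of
  the single variable \<open>U\<close>. The sine part vanishes since \<open>V\<close> is symmetric
  and independent of \<open>U\<close>.\<close>

lemma uncorrelated_gaussian_trig:
  assumes "prob_space M"
    and gauss: "\<And>a b. centered_gaussian M (\<lambda>e. a * U e + b * V e)"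
    and uncorr: "(\<integral>e. U e * V e \<partial>M) = 0"
    and F: "trig_functional (F :: (unit \<Rightarrow> real) \<Rightarrow> real)"
  shows "(\<integral>e. F (\<lambda>_. U e) * cos (V e) \<partial>M) = (\<integral>e. F (\<lambda>_. U e) \<partial>M) * (\<integral>e. cos (V e) \<partial>M) \<and>
    (\<integral>e. F (\<lambda>_. U e) * sin (V e) \<partial>M) = 0"
proof -
  interpret prob_space M by fact
  have gU: "centered_gaussian M U" and gV: "centered_gaussian M V"
    using gauss[of 1 0] gauss[of 0 1] by simp_all
  then have [measurable]: "U \<in> borel_measurable M" "V \<in> borel_measurable M"
    by (simp_all add: centered_gaussian_def)
  define u v where "u = (\<integral>e. (U e)\<^sup>2 \<partial>M)" and "v = (\<integral>e. (V e)\<^sup>2 \<partial>M)"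
  have sq: "integrable M (\<lambda>e. (U e)\<^sup>2)" "integrable M (\<lambda>e. (V e)\<^sup>2)"
    by (intro centered_gaussian_integrable_square assms gU gV)+
  have "integrable M (\<lambda>e. U e * V e)"
    using sq by (intro integrable_mult_of_squares) auto
  note iUV = this
  \<comment> \<open>The cross term vanishes for lack of correlation, and this makes the
    characteristic function of the pair a product.\<close>
  have var: "(\<integral>e. (a * U e + b * V e)\<^sup>2 \<partial>M) = a\<^sup>2 * u + b\<^sup>2 * v" for a b
  proof -
    have "(\<integral>e. (a * U e + b * V e)\<^sup>2 \<partial>M)
      = (\<integral>e. a\<^sup>2 * (U e)\<^sup>2 + b\<^sup>2 * (V e)\<^sup>2 + (2 * a * b) * (U e * V e) \<partial>M)"
      by (intro Bochner_Integration.integral_cong) (auto simp: power2_eq_square algebra_simps)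
    then show ?thesis using sq iUV uncorr by (simp add: u_def v_def)
  qed
  have c: "(\<integral>e. cos (a * U e + b * V e) \<partial>M) = exp (- (a\<^sup>2 * u + b\<^sup>2 * v) / 2)"
    and s: "(\<integral>e. sin (a * U e + b * V e) \<partial>M) = 0" for a b
    using centered_gaussian_exp_cos[OF assms(1) gauss[of a b], of 0 1]
      centered_gaussian_exp_sin[OF assms(1) gauss[of a b], of 0 1] by (simp_all add: var)
  have i: "integrable M (\<lambda>e. cos (a * U e + b * V e))" "integrable M (\<lambda>e. sin (a * U e + b * V e))" for a b
    by (intro integrable_const_bound[where B = 1]; simp)+
  have prods: "(\<integral>e. cos (t * U e) * cos (V e) \<partial>M) = (\<integral>e. cos (t * U e) \<partial>M) * (\<integral>e. cos (V e) \<partial>M)"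
    "(\<integral>e. sin (t * U e) * cos (V e) \<partial>M) = (\<integral>e. sin (t * U e) \<partial>M) * (\<integral>e. cos (V e) \<partial>M)"
    "(\<integral>e. cos (t * U e) * sin (V e) \<partial>M) = 0" "(\<integral>e. sin (t * U e) * sin (V e) \<partial>M) = 0" for t
  proof -
    note ip = i[of t 1] and im = i[of t "-1"]
    have "(\<integral>e. cos (t * U e) * cos (V e) \<partial>M)
      = (\<integral>e. (cos (t * U e + 1 * V e) + cos (t * U e + -1 * V e)) / 2 \<partial>M)"
      by (intro Bochner_Integration.integral_cong) (auto simp: cos_add cos_diff)
    then show "(\<integral>e. cos (t * U e) * cos (V e) \<partial>M) = (\<integral>e. cos (t * U e) \<partial>M) * (\<integral>e. cos (V e) \<partial>M)"
      using ip im c[of t 1] c[of t "-1"] c[of t 0] c[of 0 1]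
      by (simp add: exp_add[symmetric] field_simps)
    have "(\<integral>e. sin (t * U e) * cos (V e) \<partial>M)
      = (\<integral>e. (sin (t * U e + 1 * V e) + sin (t * U e + -1 * V e)) / 2 \<partial>M)"
      by (intro Bochner_Integration.integral_cong) (auto simp: sin_add sin_diff)
    then show "(\<integral>e. sin (t * U e) * cos (V e) \<partial>M) = (\<integral>e. sin (t * U e) \<partial>M) * (\<integral>e. cos (V e) \<partial>M)"
      using ip im s[of t 1] s[of t "-1"] s[of t 0] by simp
    have "(\<integral>e. cos (t * U e) * sin (V e) \<partial>M)
      = (\<integral>e. (sin (t * U e + 1 * V e) - sin (t * U e + -1 * V e)) / 2 \<partial>M)"
      by (intro Bochner_Integration.integral_cong) (auto simp: sin_add sin_diff)
    then show "(\<integral>e. cos (t * U e) * sin (V e) \<partial>M) = 0"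
      using ip im s[of t 1] s[of t "-1"] by simp
    have "(\<integral>e. sin (t * U e) * sin (V e) \<partial>M)
      = (\<integral>e. (cos (t * U e + -1 * V e) - cos (t * U e + 1 * V e)) / 2 \<partial>M)"
      by (intro Bochner_Integration.integral_cong) (auto simp: cos_add cos_diff)
    then show "(\<integral>e. sin (t * U e) * sin (V e) \<partial>M) = 0"
      using ip im c[of t 1] c[of t "-1"] by simp
  qed
  have int: "integrable M (\<lambda>e. G (\<lambda>_. U e))" "integrable M (\<lambda>e. G (\<lambda>_. U e) * cos (V e))"
    "integrable M (\<lambda>e. G (\<lambda>_. U e) * sin (V e))" if "trig_functional (G :: (unit \<Rightarrow> real) \<Rightarrow> real)" for G
  proof -
    show "integrable M (\<lambda>e. G (\<lambda>_. U e))"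
      by (rule trig_functional_integrable[OF assms(1) that, of "\<lambda>_. U"]) simp
    then show "integrable M (\<lambda>e. G (\<lambda>_. U e) * cos (V e))" "integrable M (\<lambda>e. G (\<lambda>_. U e) * sin (V e))"
      by (auto intro!: Bochner_Integration.integrable_bound[OF \<open>integrable M (\<lambda>e. G (\<lambda>_. U e))\<close>]
        AE_I2 mult_left_le simp: abs_mult)
  qed
  show ?thesis
    using F
  proof induction
    case (cos l)
    show ?case by (simp only: linear_form_const[OF cos, of "U _"] prods)
  next
    case (sin l)
    show ?case by (simp only: linear_form_const[OF sin, of "U _"] prods)
  next
    case (scale F r)
    then show ?case by (simp add: mult.assoc)
  next
    case (add F G)
    then show ?case
      using int[OF add.hyps(1)] int[OF add.hyps(2)] by (simp add: distrib_right)
  qed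
qed

text \<open>Cameron-Martin for a pair: the weight \<open>exp (Y e)\<close> shifts \<open>X\<close>
  by its covariance with \<open>Y\<close>. Joint Gaussianity is available only through linear
  combinations, so in place of a joint density \<open>X\<close> is split into a multiple of
  \<open>Y\<close> and a remainder \<open>V\<close> uncorrelated with \<open>Y\<close>. The factor
  \<open>exp (Y e)\<close> is not a trigonometric functional; it is reached as a limit of
  polynomials in a sine.\<close>

lemma gaussian_pair_sin_exp:
  assumes "prob_space M"
    and gauss: "\<And>a b. centered_gaussian M (\<lambda>e. a * X e + b * Y e)"
  shows "(\<integral>e. sin (X e) * exp (Y e) \<partial>M)
    = exp (((\<integral>e. (Y e)\<^sup>2 \<partial>M) - (\<integral>e. (X e)\<^sup>2 \<partial>M)) / 2) * sin (\<integral>e. X e * Y e \<partial>M)"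
proof -
  interpret prob_space M by fact
  define vX vY C where "vX = (\<integral>e. (X e)\<^sup>2 \<partial>M)" and "vY = (\<integral>e. (Y e)\<^sup>2 \<partial>M)"
    and "C = (\<integral>e. X e * Y e \<partial>M)"
  \<comment> \<open>The regression coefficient of \<open>X\<close> on \<open>Y\<close>. If
    \<open>vY = 0\<close> the division yields 0, and \<open>\<alpha> * vY = C\<close> still holds
    because \<open>Y\<close> vanishes almost surely.\<close>
  define \<alpha> where "\<alpha> = C / vY"
  define V where "V e = X e - \<alpha> * Y e" for e
  have gX: "centered_gaussian M X" and gY: "centered_gaussian M Y"
    using gauss[of 1 0] gauss[of 0 1] by simp_all
  then have [measurable]: "X \<in> borel_measurable M" "Y \<in> borel_measurable M"
    by (simp_all add: centered_gaussian_def)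
  then have [measurable]: "V \<in> borel_measurable M" unfolding V_def by measurable
  have sq: "integrable M (\<lambda>e. (X e)\<^sup>2)" "integrable M (\<lambda>e. (Y e)\<^sup>2)"
    by (intro centered_gaussian_integrable_square assms gX gY)+
  have iXY: "integrable M (\<lambda>e. X e * Y e)"
    using sq by (intro integrable_mult_of_squares) auto
  have \<alpha>C: "\<alpha> * vY = C"
  proof (cases "vY = 0")
    case True
    then have "AE e in M. (Y e)\<^sup>2 = 0"
      using sq(2) by (subst integral_nonneg_eq_0_iff_AE[symmetric]) (auto simp: vY_def)
    then have "C = (\<integral>e. 0 \<partial>M)"
      unfolding C_def by (intro integral_cong_AE) auto
    then show ?thesis using True by simp
  qed (simp add: \<alpha>_def)
  have "centered_gaussian M (\<lambda>e. a * Y e + b * V e)" for a b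
    using gauss[of b "a - b * \<alpha>"] by (simp add: V_def algebra_simps)
  note gYV = this
  have gV: "centered_gaussian M V" using gYV[of 0 1] by simp
  have uncorr: "(\<integral>e. Y e * V e \<partial>M) = 0"
  proof -
    have "(\<integral>e. Y e * V e \<partial>M) = (\<integral>e. X e * Y e - \<alpha> * (Y e)\<^sup>2 \<partial>M)"
      by (intro Bochner_Integration.integral_cong) (auto simp: V_def power2_eq_square algebra_simps)
    then show ?thesis using iXY sq \<alpha>C by (simp add: C_def vY_def)
  qed
  define vV where "vV = (\<integral>e. (V e)\<^sup>2 \<partial>M)"
  have vV: "vV = vX - \<alpha>\<^sup>2 * vY"
  proof -
    have "vV = (\<integral>e. (X e)\<^sup>2 - 2 * \<alpha> * (X e * Y e) + \<alpha>\<^sup>2 * (Y e)\<^sup>2 \<partial>M)"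
      unfolding vV_def V_def
      by (intro Bochner_Integration.integral_cong) (auto simp: power2_eq_square algebra_simps)
    also have "\<dots> = vX - 2 * \<alpha> * C + \<alpha>\<^sup>2 * vY"
      using iXY sq by (simp add: vX_def vY_def C_def)
    also have "\<dots> = vX - \<alpha>\<^sup>2 * vY"
      by (simp add: \<alpha>C[symmetric] power2_eq_square algebra_simps)
    finally show ?thesis .
  qed
  obtain q u where q: "\<And>n. real_polynomial_function (q n)"
    and qb: "\<And>n x. \<bar>q n (sin (u n * x))\<bar> \<le> 2 * exp (1 * \<bar>x\<bar>)"
    and ql: "\<And>x. (\<lambda>n. q n (sin (u n * x))) \<longlonglongrightarrow> exp (1 * x)"
    using exp_approx_sin_polynomial[of 1] by auto
  have "continuous_on UNIV (q n)" for n
    using q by (simp add: continuous_on_polymonial_function real_polynomial_function_eq)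
  then have [measurable]: "q n \<in> borel_measurable borel" for n
    by (rule borel_measurable_continuous_onI)
  \<comment> \<open>Trigonometric approximants of the two functions of \<open>Y\<close> that arise
    when the sine of \<open>\<alpha> * Y e + V e\<close> is expanded and multiplied by
    \<open>exp (Y e)\<close>.\<close>
  define S where "S n x = sin (\<alpha> * x) * q n (sin (u n * x))" for n x
  define D where "D n x = cos (\<alpha> * x) * q n (sin (u n * x))" for n x
  have [measurable]: "S n \<in> borel_measurable borel" "D n \<in> borel_measurable borel" for n
    unfolding S_def D_def by measurable
  have trig: "trig_functional (\<lambda>x :: unit \<Rightarrow> real. S n (x ()))" "trig_functional (\<lambda>x :: unit \<Rightarrow> real. D n (x ()))" for n
    unfolding S_def D_def
    by (intro trig_functional_mult trig_functional_polynomial_sin q trig_functional.sin trig_functional.cos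
        linear_form_single)+
  have lim: "(\<lambda>n. S n x) \<longlonglongrightarrow> sin (\<alpha> * x) * exp x" "(\<lambda>n. D n x) \<longlonglongrightarrow> cos (\<alpha> * x) * exp x" for x
    unfolding S_def D_def using tendsto_mult[OF tendsto_const ql[of x]] by simp_all
  have conv: "(\<lambda>n. \<integral>e. R n (Y e) * g (V e) \<partial>M) \<longlonglongrightarrow> (\<integral>e. r (Y e) * g (V e) \<partial>M)"
    if [measurable]: "\<And>n. R n \<in> borel_measurable borel" "r \<in> borel_measurable borel" "g \<in> borel_measurable borel"
      and b: "\<And>n x. \<bar>R n x\<bar> \<le> 2 * exp \<bar>x\<bar>" "\<And>x. \<bar>g x\<bar> \<le> 1" and l: "\<And>x. (\<lambda>n. R n x) \<longlonglongrightarrow> r x"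
    for R r and g :: "real \<Rightarrow> real"
  proof (rule integral_dominated_convergence[where w = "\<lambda>e. 2 * exp (1 * \<bar>Y e\<bar>)"])
    show "integrable M (\<lambda>e. 2 * exp (1 * \<bar>Y e\<bar>))"
      by (intro integrable_mult_right centered_gaussian_integrable_exp_abs[OF assms(1) gY])
    show "AE e in M. (\<lambda>n. R n (Y e) * g (V e)) \<longlonglongrightarrow> r (Y e) * g (V e)"
      using l by (auto intro!: tendsto_mult)
    have "\<bar>R n (Y e) * g (V e)\<bar> \<le> 2 * exp \<bar>Y e\<bar> * 1" for n e
      unfolding abs_mult using b by (intro mult_mono) auto
    then show "AE e in M. norm (R n (Y e) * g (V e)) \<le> 2 * exp (1 * \<bar>Y e\<bar>)" for n
      by simp
  qed measurable
  have SD_bound: "\<bar>S n x\<bar> \<le> 2 * exp \<bar>x\<bar>" "\<bar>D n x\<bar> \<le> 2 * exp \<bar>x\<bar>" for n x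
  proof -
    have "\<bar>c * q n (sin (u n * x))\<bar> \<le> 1 * (2 * exp \<bar>x\<bar>)" if "\<bar>c\<bar> \<le> 1" for c
      unfolding abs_mult using qb[of n x] that by (intro mult_mono) auto
    then show "\<bar>S n x\<bar> \<le> 2 * exp \<bar>x\<bar>" "\<bar>D n x\<bar> \<le> 2 * exp \<bar>x\<bar>"
      unfolding S_def D_def by simp_all
  qed
  note orth = uncorrelated_gaussian_trig[OF assms(1) gYV uncorr]
  \<comment> \<open>By independence this sequence is also the sequence of joint expectations with
    \<open>cos (V e)\<close>, so its limit can be computed in two ways. The factor 1 is the choice
    of \<open>g\<close> that lets \<open>conv\<close> handle the marginal.\<close>
  have "(\<lambda>n. (\<integral>e. S n (Y e) * 1 \<partial>M) * (\<integral>e. cos (V e) \<partial>M))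
      \<longlonglongrightarrow> (\<integral>e. sin (\<alpha> * Y e) * exp (Y e) * 1 \<partial>M) * (\<integral>e. cos (V e) \<partial>M)"
    by (intro tendsto_mult tendsto_const conv[of S "\<lambda>x. sin (\<alpha> * x) * exp x" "\<lambda>_. 1"])
      (use SD_bound lim in auto)
  moreover have "(\<lambda>n. (\<integral>e. S n (Y e) * 1 \<partial>M) * (\<integral>e. cos (V e) \<partial>M))
      \<longlonglongrightarrow> (\<integral>e. sin (\<alpha> * Y e) * exp (Y e) * cos (V e) \<partial>M)"
    using conv[of S "\<lambda>x. sin (\<alpha> * x) * exp x" cos] SD_bound lim orth[OF trig(1)] by simp
  ultimately have 1: "(\<integral>e. sin (\<alpha> * Y e) * exp (Y e) * cos (V e) \<partial>M)
      = (\<integral>e. sin (\<alpha> * Y e) * exp (Y e) \<partial>M) * (\<integral>e. cos (V e) \<partial>M)"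
    using LIMSEQ_unique by fastforce
  have "(\<lambda>n. \<integral>e. D n (Y e) * sin (V e) \<partial>M) \<longlonglongrightarrow> (\<integral>e. cos (\<alpha> * Y e) * exp (Y e) * sin (V e) \<partial>M)"
    using conv[of D "\<lambda>x. cos (\<alpha> * x) * exp x" sin] SD_bound lim by simp
  then have 2: "(\<integral>e. cos (\<alpha> * Y e) * exp (Y e) * sin (V e) \<partial>M) = 0"
    using orth[OF trig(2)] by (simp add: LIMSEQ_const_iff)
  have i: "integrable M (\<lambda>e. sin (\<alpha> * Y e) * exp (Y e) * cos (V e))"
    "integrable M (\<lambda>e. cos (\<alpha> * Y e) * exp (Y e) * sin (V e))"
  proof -
    have e: "integrable M (\<lambda>e. exp (1 * Y e))"
      by (rule centered_gaussian_integrable_exp[OF assms(1) gY])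
    have b: "\<bar>x * exp y * z\<bar> \<le> exp y" if "\<bar>x\<bar> \<le> 1" "\<bar>z\<bar> \<le> 1" for x y z :: real
      using mult_mono[of "\<bar>x\<bar>" 1 "\<bar>z\<bar>" 1] that by (simp add: abs_mult mult.commute mult.left_commute)
    show "integrable M (\<lambda>e. sin (\<alpha> * Y e) * exp (Y e) * cos (V e))"
      "integrable M (\<lambda>e. cos (\<alpha> * Y e) * exp (Y e) * sin (V e))"
      by (rule Bochner_Integration.integrable_bound[OF e], measurable, use b in simp)+
  qed
  have "(\<integral>e. sin (X e) * exp (Y e) \<partial>M)
    = (\<integral>e. sin (\<alpha> * Y e) * exp (Y e) * cos (V e) + cos (\<alpha> * Y e) * exp (Y e) * sin (V e) \<partial>M)"
  proof (intro Bochner_Integration.integral_cong refl)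
    fix e
    have "sin (X e) = sin (\<alpha> * Y e + V e)" by (simp add: V_def)
    then show "sin (X e) * exp (Y e)
      = sin (\<alpha> * Y e) * exp (Y e) * cos (V e) + cos (\<alpha> * Y e) * exp (Y e) * sin (V e)"
      by (simp add: sin_add algebra_simps)
  qed
  also have "\<dots> = (\<integral>e. exp (1 * Y e) * sin (\<alpha> * Y e) \<partial>M) * (\<integral>e. exp (0 * V e) * cos (1 * V e) \<partial>M)"
    using i 1 2 by (simp add: mult.commute)
  also have "\<dots> = (exp ((1\<^sup>2 - \<alpha>\<^sup>2) * vY / 2) * sin (1 * \<alpha> * vY)) * (exp ((0\<^sup>2 - 1\<^sup>2) * vV / 2) * cos (0 * 1 * vV))"
    unfolding vY_def vV_def
    by (simp only: centered_gaussian_exp_sin[OF assms(1) gY] centered_gaussian_exp_cos[OF assms(1) gV])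
  also have "\<dots> = exp ((1 - \<alpha>\<^sup>2) * vY / 2 + - vV / 2) * sin C"
    unfolding exp_add by (simp add: \<alpha>C)
  \<comment> \<open>The variance of \<open>X\<close> splits as
    \<open>\<alpha>\<^sup>2 * vY + vV\<close>, so \<alpha> disappears from the exponent.\<close>
  also have "(1 - \<alpha>\<^sup>2) * vY / 2 + - vV / 2 = (vY - vX) / 2"
    by (simp add: vV field_simps)
  finally show ?thesis by (simp add: vX_def vY_def C_def)
qed

section \<open>Monotonicity in the inverse temperature\<close>

lemma (in pair_prob_space) integral_product_of_bounded:
  fixes f :: "'a \<Rightarrow> real" and g :: "'b \<Rightarrow> real"
  assumes [measurable]: "f \<in> borel_measurable M1" "g \<in> borel_measurable M2"
    and "\<And>x. \<bar>f x\<bar> \<le> 1" "\<And>y. \<bar>g y\<bar> \<le> 1"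
  shows "integrable (M1 \<Otimes>\<^sub>M M2) (\<lambda>z. f (fst z) * g (snd z))"
    and "(\<integral>z. f (fst z) * g (snd z) \<partial>(M1 \<Otimes>\<^sub>M M2)) = (\<integral>x. f x \<partial>M1) * (\<integral>y. g y \<partial>M2)"
proof -
  have "\<bar>f x * g y\<bar> \<le> 1 * 1" for x y
    unfolding abs_mult using assms by (intro mult_mono) auto
  then show i: "integrable (M1 \<Otimes>\<^sub>M M2) (\<lambda>z. f (fst z) * g (snd z))"
    by (intro P.integrable_const_bound[where B = 1]) auto
  show "(\<integral>z. f (fst z) * g (snd z) \<partial>(M1 \<Otimes>\<^sub>M M2)) = (\<integral>x. f x \<partial>M1) * (\<integral>y. g y \<partial>M2)"
    using integral_fst'[OF i] by simp
qed

lemma linear_form_lincomb: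
  assumes "linear_form l"
  shows "l (\<lambda>i. r * x i + s * y i) = r * l x + s * l y"
  using assms by (auto simp: linear_form_def sum.distrib sum_distrib_left algebra_simps)

text \<open>Tonelli: a bound on the sections that is uniform in \<open>w\<close> suffices because
  \<open>W\<close> has mass 1.\<close>

lemma integrable_pair_of_sections_le:
  fixes f :: "'a \<times> 'b \<Rightarrow> real"
  assumes "prob_space W" "prob_space N"
    and [measurable]: "f \<in> borel_measurable (W \<Otimes>\<^sub>M N)" and "\<And>z. 0 \<le> f z"
    and le: "\<And>w. w \<in> space W \<Longrightarrow> (\<integral>\<^sup>+z. f (w, z) \<partial>N) \<le> ennreal C"
  shows "integrable (W \<Otimes>\<^sub>M N) f"
proof (rule integrableI_nonneg)
  interpret W: prob_space W by fact
  interpret N: prob_space N by fact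
  have "(\<integral>\<^sup>+z. f z \<partial>(W \<Otimes>\<^sub>M N)) = (\<integral>\<^sup>+w. \<integral>\<^sup>+z. f (w, z) \<partial>N \<partial>W)"
    by (rule N.nn_integral_fst[symmetric]) simp
  also have "\<dots> \<le> (\<integral>\<^sup>+w. ennreal C \<partial>W)"
    by (intro nn_integral_mono le)
  also have "\<dots> < \<infinity>" by (simp add: W.emeasure_space_1)
  finally show "(\<integral>\<^sup>+z. f z \<partial>(W \<Otimes>\<^sub>M N)) < \<infinity>" .
qed (use assms in auto)

text \<open>The Hamiltonian at a fixed time, with paths as indices. The variance is the same at
  every index, which allows the normalisation to be pulled out of the integral over \<open>W\<close>
  and makes exponential moments uniform in \<open>w\<close>.\<close>

locale gaussian_field = W: prob_space W + M: prob_space M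
  for W :: "'w measure" and M :: "'e measure" +
  fixes K :: "'w \<Rightarrow> 'e \<Rightarrow> real" and v :: real
  assumes space_W: "space W = UNIV"
    and K[measurable]: "case_prod K \<in> borel_measurable (W \<Otimes>\<^sub>M M)"
    and gaussian: "\<And>l. linear_form l \<Longrightarrow> centered_gaussian M (\<lambda>e. l (\<lambda>w. K w e))"
    and variance: "\<And>w. (\<integral>e. (K w e)\<^sup>2 \<partial>M) = v"
begin

definition mass :: "real \<Rightarrow> 'e \<Rightarrow> real" where
  "mass a e = (\<integral>w. exp (a * K w e - a\<^sup>2 / 2 * v) \<partial>W)"

lemma mass_eq: "mass a e = exp (- (a\<^sup>2 / 2 * v)) * (\<integral>w. exp (a * K w e) \<partial>W)"
proof -
  have "exp (a * K w e - a\<^sup>2 / 2 * v) = exp (- (a\<^sup>2 / 2 * v)) * exp (a * K w e)" for w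
    unfolding exp_add[symmetric] by simp
  then show ?thesis unfolding mass_def by simp
qed

lemma v_nonneg: "0 \<le> v"
  using variance[of undefined] by (metis Bochner_Integration.integral_nonneg zero_le_power2)

lemma gaussian_K: "centered_gaussian M (K w)"
  using gaussian[OF linear_form_single[of 1 w]] by simp

lemma K_measurable: "K w \<in> borel_measurable M"
  using gaussian_K by (simp add: centered_gaussian_def)

lemma integrable_exp_K: "integrable M (\<lambda>e. exp (a * K w e))"
  by (rule centered_gaussian_integrable_exp[OF M.prob_space_axioms gaussian_K])

lemma integral_exp_K: "(\<integral>e. exp (a * K w e) \<partial>M) = exp (a\<^sup>2 * v / 2)"
  using centered_gaussian_exp[OF M.prob_space_axioms gaussian_K] by (simp add: variance)

lemma nn_integral_exp_K: "(\<integral>\<^sup>+e. ennreal (exp (a * K w e)) \<partial>M) = ennreal (exp (a\<^sup>2 * v / 2))"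
  by (subst nn_integral_eq_integral[OF integrable_exp_K]) (auto simp: integral_exp_K)

lemma integrable_pair_exp: "integrable (W \<Otimes>\<^sub>M M) (\<lambda>(w, e). exp (a * K w e))"
  by (rule integrable_pair_of_sections_le[OF W.prob_space_axioms M.prob_space_axioms, where C = "exp (a\<^sup>2 * v / 2)"])
    (auto simp: nn_integral_exp_K)

lemma integrable_pair_exp_abs: "integrable (W \<Otimes>\<^sub>M M) (\<lambda>(w, e). exp (a * \<bar>K w e\<bar>))"
  using integrable_exp_abs_of_exp[of "W \<Otimes>\<^sub>M M" a "case_prod K"]
    integrable_pair_exp[of a] integrable_pair_exp[of "- a"] by (simp add: case_prod_beta')

text \<open>The field with parameter \<open>b\<close> has the same law as the field with parameter \<open>a\<close> plus an
  independent Gaussian field, so up to its law the mass with parameter \<open>a\<close> is a conditional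
  expectation of the mass with parameter \<open>b\<close>; Jensen's inequality does the rest.\<close>

lemma excess_mass_mono:
  assumes "0 \<le> a" "a \<le> b" "0 < b"
  shows "(\<integral>e. max 0 (mass a e - k) \<partial>M) \<le> (\<integral>e. max 0 (mass b e - k) \<partial>M)"
proof -
  interpret MM: pair_prob_space M M ..
  interpret WM: pair_prob_space W M ..
  let ?N = "M \<Otimes>\<^sub>M M"
  interpret WN: pair_prob_space W ?N ..
  \<comment> \<open>The identity \<open>r\<^sup>2 + s\<^sup>2 = 1\<close> preserves the covariance
    of the field, and \<open>b * r = a\<close> makes the first component carry exactly the parameter
    \<open>a\<close>.\<close>
  define r s where "r = a / b" and "s = sqrt (1 - r\<^sup>2)"
  have "0 \<le> r" "r \<le> 1" using assms by (auto simp: r_def)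
  then have rs: "s\<^sup>2 = 1 - r\<^sup>2" "r\<^sup>2 + s\<^sup>2 = 1" and br: "b * r = a"
    using assms by (auto simp: s_def r_def power_le_one)
  \<comment> \<open>The second coordinate of \<open>M \<Otimes>\<^sub>M M\<close> supplies the
    independent copy of the field.\<close>
  define K' where "K' w z = r * K w (fst z) + s * K w (snd z)" for w z
  have m1: "(\<lambda>x. K (fst x) (fst (snd x))) \<in> borel_measurable (W \<Otimes>\<^sub>M ?N)"
    and m2: "(\<lambda>x. K (fst x) (snd (snd x))) \<in> borel_measurable (W \<Otimes>\<^sub>M ?N)"
  proof -
    have "(\<lambda>x. (fst x, fst (snd x))) \<in> W \<Otimes>\<^sub>M ?N \<rightarrow>\<^sub>M W \<Otimes>\<^sub>M M"
      "(\<lambda>x. (fst x, snd (snd x))) \<in> W \<Otimes>\<^sub>M ?N \<rightarrow>\<^sub>M W \<Otimes>\<^sub>M M"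
      by measurable
    from this[THEN measurable_compose, OF K]
    show "(\<lambda>x. K (fst x) (fst (snd x))) \<in> borel_measurable (W \<Otimes>\<^sub>M ?N)"
      "(\<lambda>x. K (fst x) (snd (snd x))) \<in> borel_measurable (W \<Otimes>\<^sub>M ?N)" by simp_all
  qed
  have K'm[measurable]: "case_prod K' \<in> borel_measurable (W \<Otimes>\<^sub>M ?N)"
    unfolding K'_def case_prod_beta using m1 m2 by measurable
  have exp_int: "integrable (W \<Otimes>\<^sub>M ?N) (\<lambda>(w, z). exp (c * K' w z))" for c
  proof (rule integrable_pair_of_sections_le[OF W.prob_space_axioms MM.prob_space_axioms,
        where C = "exp ((c * r)\<^sup>2 * v / 2) * exp ((c * s)\<^sup>2 * v / 2)"])
    fix w
    have [measurable]: "K w \<in> borel_measurable M" by (rule K_measurable)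
    have "(\<integral>\<^sup>+z. ennreal (case (w, z) of (w, z) \<Rightarrow> exp (c * K' w z)) \<partial>?N)
      = (\<integral>\<^sup>+x. \<integral>\<^sup>+y. ennreal (exp (c * r * K w x)) * ennreal (exp (c * s * K w y)) \<partial>M \<partial>M)"
      by (subst M.nn_integral_fst[symmetric])
        (auto simp: K'_def ennreal_mult[symmetric] exp_add[symmetric] algebra_simps)
    also have "\<dots> = ennreal (exp ((c * r)\<^sup>2 * v / 2)) * ennreal (exp ((c * s)\<^sup>2 * v / 2))"
      by (simp add: nn_integral_cmult nn_integral_multc nn_integral_exp_K)
    finally show "(\<integral>\<^sup>+z. ennreal (case (w, z) of (w, z) \<Rightarrow> exp (c * K' w z)) \<partial>?N)
      \<le> ennreal (exp ((c * r)\<^sup>2 * v / 2) * exp ((c * s)\<^sup>2 * v / 2))"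
      by (simp add: ennreal_mult)
  qed auto
  have exp_abs: "integrable (W \<Otimes>\<^sub>M ?N) (\<lambda>(w, z). exp (b * \<bar>K' w z\<bar>))"
    using integrable_exp_abs_of_exp[of "W \<Otimes>\<^sub>M ?N" b "case_prod K'"]
      exp_int[of b] exp_int[of "- b"] by (simp add: case_prod_beta')
  \<comment> \<open>For independent copies of the Gaussian variable \<open>S\<close> with variance
    \<open>q\<close>, the characteristic functions multiply, and the variances
    \<open>r\<^sup>2 * q\<close> and \<open>s\<^sup>2 * q\<close> add up to
    \<open>q\<close>.\<close>
  have cs: "(\<integral>e. cos (l (\<lambda>w. K w e)) \<partial>M) = (\<integral>z. cos (l (\<lambda>w. K' w z)) \<partial>?N)"
    "(\<integral>e. sin (l (\<lambda>w. K w e)) \<partial>M) = (\<integral>z. sin (l (\<lambda>w. K' w z)) \<partial>?N)" if l: "linear_form l" for l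
  proof -
    define S where "S e = l (\<lambda>w. K w e)" for e
    have g: "centered_gaussian M S" unfolding S_def by (rule gaussian[OF l])
    then have [measurable]: "S \<in> borel_measurable M" by (simp add: centered_gaussian_def)
    define q where "q = (\<integral>e. (S e)\<^sup>2 \<partial>M)"
    have c: "(\<integral>e. cos (t * S e) \<partial>M) = exp (- t\<^sup>2 * q / 2)" and s0: "(\<integral>e. sin (t * S e) \<partial>M) = 0" for t
      using centered_gaussian_exp_cos[OF M.prob_space_axioms g, of 0 t]
        centered_gaussian_exp_sin[OF M.prob_space_axioms g, of 0 t] by (simp_all add: q_def)
    have lK': "l (\<lambda>w. K' w z) = r * S (fst z) + s * S (snd z)" for z
      unfolding K'_def S_def by (rule linear_form_lincomb[OF l])
    note prod = MM.integral_product_of_bounded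
    have "(\<integral>z. cos (l (\<lambda>w. K' w z)) \<partial>?N) = exp (- r\<^sup>2 * q / 2) * exp (- s\<^sup>2 * q / 2)"
      unfolding lK' cos_add
      using prod[of "\<lambda>x. cos (r * S x)" "\<lambda>x. cos (s * S x)"] prod[of "\<lambda>x. sin (r * S x)" "\<lambda>x. sin (s * S x)"]
      by (simp add: c s0)
    also have "\<dots> = exp (- q / 2)"
      unfolding exp_add[symmetric] rs(1) by (simp add: field_simps)
    finally show "(\<integral>e. cos (l (\<lambda>w. K w e)) \<partial>M) = (\<integral>z. cos (l (\<lambda>w. K' w z)) \<partial>?N)"
      using c[of 1] by (simp add: S_def)
    have "(\<integral>z. sin (l (\<lambda>w. K' w z)) \<partial>?N) = 0"
      unfolding lK' sin_add
      using prod[of "\<lambda>x. sin (r * S x)" "\<lambda>x. cos (s * S x)"] prod[of "\<lambda>x. cos (r * S x)" "\<lambda>x. sin (s * S x)"]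
      by (simp add: c s0)
    then show "(\<integral>e. sin (l (\<lambda>w. K w e)) \<partial>M) = (\<integral>z. sin (l (\<lambda>w. K' w z)) \<partial>?N)"
      using s0[of 1] by (simp add: S_def)
  qed
  \<comment> \<open>The normalisation at parameter \<open>b\<close>. It is absorbed into \<Phi>,
    which stays 1-Lipschitz because \<open>\<kappa> \<le> 1\<close>.\<close>
  define \<kappa> where "\<kappa> = exp (- (b\<^sup>2 / 2 * v))"
  have \<kappa>: "0 < \<kappa>" "\<kappa> \<le> 1" using v_nonneg by (auto simp: \<kappa>_def)
  define T where "T z = \<kappa> * (\<integral>w. exp (b * K' w z) \<partial>W)" for z
  define \<Phi> where "\<Phi> x = max 0 (\<kappa> * x - k)" for x
  have "\<bar>\<Phi> x - \<Phi> y\<bar> \<le> \<bar>x - y\<bar>" for x y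
  proof -
    have "\<bar>\<Phi> x - \<Phi> y\<bar> \<le> \<bar>\<kappa> * x - \<kappa> * y\<bar>" by (auto simp: \<Phi>_def max_def)
    also have "\<dots> = \<kappa> * \<bar>x - y\<bar>" using \<kappa> by (simp add: right_diff_distrib[symmetric] abs_mult)
    also have "\<dots> \<le> \<bar>x - y\<bar>" using \<kappa> by (simp add: mult_left_le_one_le)
    finally show ?thesis .
  qed
  from exp_mass_law_eq[OF W.prob_space_axioms space_W M.prob_space_axioms MM.prob_space_axioms K K'm cs
      less_imp_le[OF assms(3)] integrable_pair_exp_abs exp_abs this]
  have law: "(\<integral>e. max 0 (mass b e - k) \<partial>M) = (\<integral>z. max 0 (T z - k) \<partial>?N)"
    by (simp add: \<Phi>_def mass_eq T_def \<kappa>_def)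
  have iT: "integrable ?N T"
    unfolding T_def using WN.integrable_snd[OF exp_int[of b]] by simp
  then have iTk: "integrable ?N (\<lambda>z. max 0 (T z - k))" by (intro integrable_max) auto
  \<comment> \<open>Jensen's inequality for the positive part, conditionally on the first
    coordinate.\<close>
  have "(\<integral>e. max 0 (mass a e - k) \<partial>M) \<le> (\<integral>e. (\<integral>e'. max 0 (T (e, e') - k) \<partial>M) \<partial>M)"
  proof (rule integral_mono_AE)
    show "integrable M (\<lambda>e. max 0 (mass a e - k))"
      unfolding mass_eq using WM.integrable_snd[OF integrable_pair_exp[of a]] by (intro integrable_max) auto
    show "integrable M (\<lambda>e. \<integral>e'. max 0 (T (e, e') - k) \<partial>M)"
      by (rule MM.integrable_fst'[OF iTk])
    show "AE e in M. max 0 (mass a e - k) \<le> (\<integral>e'. max 0 (T (e, e') - k) \<partial>M)"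
      using WM.AE_integrable_snd[OF integrable_pair_exp[of a]] MM.AE_integrable_fst'[OF iT]
        MM.AE_integrable_fst'[OF iTk] AE_space
    proof eventually_elim
      case (elim e)
      have [measurable]: "(\<lambda>w. K w e) \<in> borel_measurable W"
        using measurable_compose[OF measurable_Pair2'[OF elim(4)] K] by simp
      have K2: "(\<lambda>x. K (fst x) (snd x)) \<in> borel_measurable (W \<Otimes>\<^sub>M M)"
        using K by (simp add: case_prod_beta')
      \<comment> \<open>For fixed \<open>e\<close> the integrand factors: the first factor is
        integrable over paths for almost every \<open>e\<close>, and the second has an expectation
        that does not depend on the path.\<close>
      have i: "integrable (W \<Otimes>\<^sub>M M) (\<lambda>(w, e'). exp (b * K' w (e, e')))"
      proof (rule integrableI_nonneg)
        have "(\<integral>\<^sup>+x. ennreal (case x of (w, e') \<Rightarrow> exp (b * K' w (e, e'))) \<partial>(W \<Otimes>\<^sub>M M))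
          = (\<integral>\<^sup>+w. \<integral>\<^sup>+e'. ennreal (exp (a * K w e)) * ennreal (exp (b * s * K w e')) \<partial>M \<partial>W)"
          by (subst M.nn_integral_fst[symmetric])
            (auto simp: K'_def ennreal_mult[symmetric] exp_add[symmetric] algebra_simps br[symmetric])
        also have "\<dots> = (\<integral>\<^sup>+w. ennreal (exp (a * K w e)) \<partial>W) * ennreal (exp ((b * s)\<^sup>2 * v / 2))"
          using K_measurable by (simp add: nn_integral_cmult nn_integral_multc nn_integral_exp_K)
        also have "\<dots> < \<infinity>"
          using elim(1) by (simp add: integrable_iff_bounded ennreal_mult_less_top)
        finally show "(\<integral>\<^sup>+x. ennreal (case x of (w, e') \<Rightarrow> exp (b * K' w (e, e'))) \<partial>(W \<Otimes>\<^sub>M M)) < \<infinity>" .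
        show "(\<lambda>(w, e'). exp (b * K' w (e, e'))) \<in> borel_measurable (W \<Otimes>\<^sub>M M)"
          unfolding K'_def case_prod_beta' fst_conv snd_conv using K2 by measurable
      qed auto
      have "(\<integral>e'. T (e, e') \<partial>M) = \<kappa> * (\<integral>w. (\<integral>e'. exp (b * K' w (e, e')) \<partial>M) \<partial>W)"
        unfolding T_def using WM.Fubini_integral[OF i] by simp
      also have "(\<integral>w. (\<integral>e'. exp (b * K' w (e, e')) \<partial>M) \<partial>W)
        = (\<integral>w. exp (a * K w e) * (\<integral>e'. exp (b * s * K w e') \<partial>M) \<partial>W)"
        by (simp add: K'_def distrib_left exp_add mult.assoc[symmetric] br)
      also have "\<dots> = exp ((b * s)\<^sup>2 * v / 2) * (\<integral>w. exp (a * K w e) \<partial>W)"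
        by (simp add: integral_exp_K)
      also have "\<kappa> * \<dots> = exp (- (b\<^sup>2 / 2 * v) + (b * s)\<^sup>2 * v / 2) * (\<integral>w. exp (a * K w e) \<partial>W)"
        unfolding exp_add by (simp add: \<kappa>_def)
      \<comment> \<open>Averaging over the second coordinate produces the exponent
        \<open>(b * s)\<^sup>2 * v / 2\<close>, which turns the normalisation at \<open>b\<close>
        into the one at \<open>a\<close>, since
        \<open>b\<^sup>2 - (b * s)\<^sup>2 = a\<^sup>2\<close>.\<close>
      also have "- (b\<^sup>2 / 2 * v) + (b * s)\<^sup>2 * v / 2 = - (a\<^sup>2 / 2 * v)"
        unfolding br[symmetric] power_mult_distrib rs(1) by (simp add: field_simps)
      finally have mass_T: "mass a e = (\<integral>e'. T (e, e') \<partial>M)" by (simp add: mass_eq)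
      have "(\<integral>e'. T (e, e') - k \<partial>M) \<le> (\<integral>e'. max 0 (T (e, e') - k) \<partial>M)"
        using elim by (intro integral_mono) auto
      then have "mass a e - k \<le> (\<integral>e'. max 0 (T (e, e') - k) \<partial>M)"
        using elim by (simp add: mass_T M.prob_space)
      moreover have "0 \<le> (\<integral>e'. max 0 (T (e, e') - k) \<partial>M)"
        by (intro Bochner_Integration.integral_nonneg) simp
      ultimately show ?case by simp
    qed
  qed
  also have "\<dots> = (\<integral>z. max 0 (T z - k) \<partial>?N)"
    by (rule MM.integral_fst'[OF iTk])
  finally show ?thesis unfolding law .
qed

end

section \<open>Passing to the limit under bounded excess\<close>

text \<open>Fatou's lemma, stated for Bochner integrals; integrability of the limit comes from the
  same bound.\<close>

lemma nonneg_integral_limit_le: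
  fixes f :: "nat \<Rightarrow> 'e \<Rightarrow> real"
  assumes "\<And>n. integrable M (f n)" "g \<in> borel_measurable M"
    and "\<And>n e. 0 \<le> f n e" "\<And>e. 0 \<le> g e"
    and lim: "AE e in M. (\<lambda>n. f n e) \<longlonglongrightarrow> g e" and le: "\<And>n. (\<integral>e. f n e \<partial>M) \<le> C"
  shows "integrable M g" and "(\<integral>e. g e \<partial>M) \<le> C"
proof -
  have [measurable]: "f n \<in> borel_measurable M" for n using assms(1) by blast
  note [measurable] = assms(2)
  have "0 \<le> C" using le[of 0] assms(3) by (meson Bochner_Integration.integral_nonneg order_trans)
  have "(\<integral>\<^sup>+e. ennreal (g e) \<partial>M) = (\<integral>\<^sup>+e. liminf (\<lambda>n. ennreal (f n e)) \<partial>M)"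
    by (intro nn_integral_cong_AE, use lim in eventually_elim)
      (auto intro!: lim_imp_Liminf[symmetric] tendsto_ennrealI)
  also have "\<dots> \<le> liminf (\<lambda>n. \<integral>\<^sup>+e. ennreal (f n e) \<partial>M)"
    by (rule nn_integral_liminf) simp
  also have "\<dots> \<le> limsup (\<lambda>n. \<integral>\<^sup>+e. ennreal (f n e) \<partial>M)"
    by (intro Liminf_le_Limsup) simp
  also have "\<dots> \<le> ennreal C"
    using assms(1,3) le by (intro Limsup_bounded always_eventually) (simp add: nn_integral_eq_integral ennreal_leI)
  finally have *: "(\<integral>\<^sup>+e. ennreal (g e) \<partial>M) \<le> ennreal C" .
  show i: "integrable M g"
    using * assms(4) by (intro integrableI_nonneg) (auto intro: le_less_trans)
  show "(\<integral>e. g e \<partial>M) \<le> C"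
    using * assms(4) \<open>0 \<le> C\<close> by (simp add: nn_integral_eq_integral[OF i] ennreal_le_iff)
qed

text \<open>Each variable is cut at a level \<open>k\<close>. The truncated parts converge by
  bounded convergence; the excess above \<open>k\<close> is uniformly small along the sequence and,
  by Fatou, for the limit. Excess is used as the form of uniform integrability because it is a
  convex function of the mass, so that Jensen's inequality applies to it.\<close>

lemma excess_bounded_integral_limit:
  fixes Z :: "nat \<Rightarrow> 'e \<Rightarrow> real"
  assumes "prob_space M" and Z: "\<And>n. integrable M (Z n)" "\<And>n e. 0 \<le> Z n e"
    and Y[measurable]: "Y \<in> borel_measurable M" and "\<And>e. 0 \<le> Y e"
    and lim: "AE e in M. (\<lambda>n. Z n e) \<longlonglongrightarrow> Y e"
    and excess: "\<And>\<epsilon>. 0 < \<epsilon> \<Longrightarrow> \<exists>k. \<forall>n. (\<integral>e. max 0 (Z n e - k) \<partial>M) \<le> \<epsilon>"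
    and \<psi>[measurable]: "\<psi> \<in> borel_measurable M" and \<psi>1: "\<And>e. \<bar>\<psi> e\<bar> \<le> (1::real)"
    and c: "\<And>n. (\<integral>e. \<psi> e * Z n e \<partial>M) = c"
  shows "(\<integral>e. \<psi> e * Y e \<partial>M) = c"
proof -
  interpret prob_space M by fact
  have [measurable]: "Z n \<in> borel_measurable M" for n using Z(1) by blast
  have mult_le: "\<bar>\<psi> e * x\<bar> \<le> \<bar>x\<bar>" for e x
    using \<psi>1[of e] by (simp add: abs_mult mult_left_le_one_le)
  have mult_max: "\<bar>\<psi> e * max 0 x\<bar> \<le> max 0 x" for e x
    using mult_le[of e "max 0 x"] by (simp only: abs_of_nonneg max.cobounded1)
  have "\<bar>(\<integral>e. \<psi> e * Y e \<partial>M) - c\<bar> \<le> 0 + \<epsilon>" if \<epsilon>: "0 < \<epsilon>" for \<epsilon>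
  proof -
    obtain k where k: "\<And>n. (\<integral>e. max 0 (Z n e - k) \<partial>M) \<le> \<epsilon> / 2"
      using excess[OF half_gt_zero[OF \<epsilon>]] by auto
    have split: "x = min x k + max 0 (x - k)" for x :: real by auto
    have iZ: "integrable M (\<lambda>e. max 0 (Z n e - k))" for n
      using Z by (intro integrable_max) auto
    have Yk: "integrable M (\<lambda>e. max 0 (Y e - k))" "(\<integral>e. max 0 (Y e - k) \<partial>M) \<le> \<epsilon> / 2"
    proof -
      have "AE e in M. (\<lambda>n. max 0 (Z n e - k)) \<longlonglongrightarrow> max 0 (Y e - k)"
        using lim by eventually_elim (intro tendsto_intros)
      from nonneg_integral_limit_le[OF iZ _ _ _ this k]
      show "integrable M (\<lambda>e. max 0 (Y e - k))" "(\<integral>e. max 0 (Y e - k) \<partial>M) \<le> \<epsilon> / 2" by auto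
    qed
    \<comment> \<open>For nonnegative \<open>x\<close> this holds whatever the sign of
      \<open>k\<close>, so no sign has to be known for the level obtained above.\<close>
    have mink: "\<bar>min x k\<bar> \<le> \<bar>k\<bar>" if "0 \<le> x" for x using that by linarith
    have bnd: "\<bar>\<psi> e * min x k\<bar> \<le> \<bar>k\<bar>" if "0 \<le> x" for e x
      using mult_le[of e "min x k"] mink[OF that] by linarith
    have imin: "integrable M (\<lambda>e. \<psi> e * min (Z n e) k)" "integrable M (\<lambda>e. \<psi> e * min (Y e) k)" for n
      using bnd assms(5) Z(2) by (auto intro!: integrable_const_bound[where B = "\<bar>k\<bar>"] AE_I2)
    have imax: "integrable M (\<lambda>e. \<psi> e * max 0 (X e - k))" "\<bar>\<integral>e. \<psi> e * max 0 (X e - k) \<partial>M\<bar> \<le> \<epsilon> / 2"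
      if X: "integrable M (\<lambda>e. max 0 (X e - k))" "(\<integral>e. max 0 (X e - k) \<partial>M) \<le> \<epsilon> / 2" "X \<in> borel_measurable M" for X
    proof -
      note [measurable] = X(3)
      show i: "integrable M (\<lambda>e. \<psi> e * max 0 (X e - k))"
        by (rule Bochner_Integration.integrable_bound[OF X(1)])
          (measurable, use mult_max in \<open>simp only: real_norm_def AE_I2 order_trans[OF _ abs_ge_self]\<close>)
      have "\<bar>\<integral>e. \<psi> e * max 0 (X e - k) \<partial>M\<bar> \<le> (\<integral>e. max 0 (X e - k) \<partial>M)"
      proof (rule order_trans[OF integral_abs_bound], rule integral_mono[OF integrable_abs[OF i] X(1)])
      qed (rule mult_max)
      then show "\<bar>\<integral>e. \<psi> e * max 0 (X e - k) \<partial>M\<bar> \<le> \<epsilon> / 2" using X(2) by linarith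
    qed
    have dec: "(\<integral>e. \<psi> e * X e \<partial>M) = (\<integral>e. \<psi> e * min (X e) k \<partial>M) + (\<integral>e. \<psi> e * max 0 (X e - k) \<partial>M)"
      if "integrable M (\<lambda>e. \<psi> e * min (X e) k)" "integrable M (\<lambda>e. \<psi> e * max 0 (X e - k))" for X
    proof -
      have "(\<integral>e. \<psi> e * X e \<partial>M) = (\<integral>e. \<psi> e * min (X e) k + \<psi> e * max 0 (X e - k) \<partial>M)"
        by (intro Bochner_Integration.integral_cong refl) (subst split, simp only: distrib_left)
      then show ?thesis using that by simp
    qed
    have "\<bar>(\<integral>e. \<psi> e * min (Z n e) k \<partial>M) - c\<bar> \<le> \<epsilon> / 2" for n
      using dec[OF imin(1)[of n] imax(1)] imax(2)[of "Z n"] iZ[of n] k[of n] c[of n] by simp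
    moreover have "(\<lambda>n. \<bar>(\<integral>e. \<psi> e * min (Z n e) k \<partial>M) - c\<bar>) \<longlonglongrightarrow> \<bar>(\<integral>e. \<psi> e * min (Y e) k \<partial>M) - c\<bar>"
    proof (intro tendsto_rabs tendsto_diff tendsto_const
        integral_dominated_convergence[where w = "\<lambda>_. \<bar>k\<bar>"])
      show "AE e in M. (\<lambda>n. \<psi> e * min (Z n e) k) \<longlonglongrightarrow> \<psi> e * min (Y e) k"
        using lim by eventually_elim (intro tendsto_intros)
      show "AE e in M. norm (\<psi> e * min (Z n e) k) \<le> \<bar>k\<bar>" for n
        using bnd Z(2) by auto
    qed auto
    ultimately have "\<bar>(\<integral>e. \<psi> e * min (Y e) k \<partial>M) - c\<bar> \<le> \<epsilon> / 2"
      by (intro LIMSEQ_le_const2) auto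
    then show ?thesis
      using dec[OF imin(2) imax(1)[OF Yk Y]] imax(2)[OF Yk Y] by linarith
  qed
  then have "\<bar>(\<integral>e. \<psi> e * Y e \<partial>M) - c\<bar> \<le> 0" by (rule field_le_epsilon)
  then show ?thesis by simp
qed

section \<open>White noise and mollifiers: basic properties\<close>

text \<open>The Hamiltonian is only a version of the noise integral, so Gaussianity has to be
  carried across almost sure equalities.\<close>

lemma centered_gaussian_cong_AE:
  assumes "centered_gaussian M X" "Y \<in> borel_measurable M" "AE e in M. X e = Y e"
  shows "centered_gaussian M Y"
proof -
  have X: "X \<in> borel_measurable M" using assms(1) by (simp add: centered_gaussian_def)
  consider "AE e in M. X e = 0"
    | \<sigma> where "\<sigma> > 0" "distributed M lborel X (\<lambda>x. ennreal (normal_density 0 \<sigma> x))"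
    using assms(1) by (auto simp: centered_gaussian_def)
  then show ?thesis
  proof cases
    case 1
    then have "AE e in M. Y e = 0" using assms(3) by eventually_elim simp
    then show ?thesis using assms(2) by (simp add: centered_gaussian_def)
  next
    case 2
    have "distr M lborel Y = distr M lborel X"
      using assms X by (intro distr_cong_AE) auto
    then have "distributed M lborel Y (\<lambda>x. ennreal (normal_density 0 \<sigma> x))"
      using 2(2) assms(2) by (simp add: distributed_def)
    then show ?thesis using assms(2) 2(1) by (auto simp: centered_gaussian_def)
  qed
qed

text \<open>The noise is Gaussian over sets of functions, but a family \<open>h\<close> may repeat a
  function: two paths that agree up to time T have the same kernel. Coefficients are therefore
  collected over the fibres of \<open>h\<close>.\<close>

lemma white_noise_sum_gaussian:
  assumes "white_noise M B" "finite J" "\<And>j. j \<in> J \<Longrightarrow> h j \<in> square_integrable spacetime"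
  shows "centered_gaussian M (\<lambda>e. \<Sum>j\<in>J. c j * B (h j) e)"
proof -
  have "(\<Sum>j\<in>J. c j * B (h j) e) = (\<Sum>f\<in>h ` J. (\<Sum>j\<in>{j \<in> J. h j = f}. c j) * B f e)" for e
  proof -
    have "(\<Sum>j\<in>J. c j * B (h j) e) = (\<Sum>f\<in>h ` J. \<Sum>j\<in>{j \<in> J. h j = f}. c j * B (h j) e)"
      by (rule sum.image_gen[OF assms(2)])
    also have "\<dots> = (\<Sum>f\<in>h ` J. (\<Sum>j\<in>{j \<in> J. h j = f}. c j) * B f e)"
      by (intro sum.cong refl) (auto simp: sum_distrib_right)
    finally show ?thesis .
  qed
  then show ?thesis
    using assms unfolding white_noise_def centered_gaussian_process_def by (simp add: image_subset_iff)
qed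

lemma white_noise_gaussian:
  assumes "white_noise M B" "f \<in> square_integrable spacetime"
  shows "centered_gaussian M (B f)"
  using white_noise_sum_gaussian[OF assms(1), of "{f}" "\<lambda>f. f" "\<lambda>_. 1"] assms(2) by simp

lemma smooth_continuous: "smooth f \<Longrightarrow> continuous_on UNIV f"
  unfolding smooth_def by (metis continuously_differentiable.simps(1))

lemma mollifier_even:
  assumes "mollifier \<phi>" shows "\<phi> (- x) = \<phi> x"
proof -
  have "norm (- x) = norm x \<longrightarrow> \<phi> (- x) = \<phi> x"
    using assms unfolding mollifier_def by blast
  then show ?thesis by simp
qed

lemma mollifier_continuous: "mollifier \<phi> \<Longrightarrow> continuous_on UNIV \<phi>"
  unfolding mollifier_def by (blast intro: smooth_continuous)

lemma mollifier_measurable: "mollifier \<phi> \<Longrightarrow> \<phi> \<in> borel_measurable borel"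
  by (intro borel_measurable_continuous_onI mollifier_continuous)

lemma mollifier_bounded:
  assumes "mollifier \<phi>"
  obtains C where "0 \<le> C" "\<And>x. \<bar>\<phi> x\<bar> \<le> C"
proof -
  have "compact (closure {x. \<phi> x \<noteq> 0})"
    using assms unfolding mollifier_def by blast
  then have "compact (\<phi> ` closure {x. \<phi> x \<noteq> 0})"
    by (intro compact_continuous_image continuous_on_subset[OF mollifier_continuous[OF assms]]) auto
  from compact_imp_bounded[OF this]
  obtain C where C: "\<forall>y\<in>\<phi> ` closure {x. \<phi> x \<noteq> 0}. norm y \<le> C"
    unfolding bounded_iff by blast
  have "\<bar>\<phi> x\<bar> \<le> max C 0" for x
  proof (cases "\<phi> x = 0")
    case False
    then have "x \<in> closure {x. \<phi> x \<noteq> 0}" using closure_subset[of "{x. \<phi> x \<noteq> 0}"] by blast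
    then have "norm (\<phi> x) \<le> C" using C by blast
    then show ?thesis by simp
  qed simp
  then show ?thesis using that[of "max C 0"] by simp
qed

text \<open>A function that is not integrable has integral 0 by convention, which the normalisation
  to 1 rules out.\<close>

lemma mollifier_integrable:
  assumes "mollifier \<phi>" shows "integrable lborel \<phi>"
proof (rule ccontr)
  assume "\<not> integrable lborel \<phi>"
  then have "(\<integral>x. \<phi> x \<partial>lborel) = 0" by (rule not_integrable_integral_eq)
  moreover have "(\<integral>x. \<phi> x \<partial>lborel) = 1" using assms unfolding mollifier_def by blast
  ultimately show False by simp
qed

lemma mollifier_integrable_mult:
  assumes "mollifier \<phi>" and [measurable]: "g \<in> borel_measurable borel" and "\<And>x. \<bar>g x\<bar> \<le> C"
  shows "integrable lborel (\<lambda>x. \<phi> x * g x)"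
proof (rule Bochner_Integration.integrable_bound)
  show "integrable lborel (\<lambda>x. C * \<phi> x)" using mollifier_integrable[OF assms(1)] by simp
  show "AE x in lborel. norm (\<phi> x * g x) \<le> norm (C * \<phi> x)"
  proof (rule AE_I2)
    fix x
    have "\<bar>g x\<bar> \<le> \<bar>C\<bar>" using assms(3)[of x] by linarith
    then show "norm (\<phi> x * g x) \<le> norm (C * \<phi> x)"
      using mult_left_mono[of "\<bar>g x\<bar>" "\<bar>C\<bar>" "\<bar>\<phi> x\<bar>"] by (simp add: abs_mult mult.commute)
  qed
qed (use mollifier_measurable[OF assms(1)] in measurable)

lemma mollifier_integrable_square:
  assumes "mollifier \<phi>" shows "integrable lborel (\<lambda>x. (\<phi> x)\<^sup>2)"
proof -
  obtain C where "\<And>x. \<bar>\<phi> x\<bar> \<le> C" using mollifier_bounded[OF assms] by blast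
  from mollifier_integrable_mult[OF assms mollifier_measurable[OF assms] this]
  show ?thesis by (simp add: power2_eq_square)
qed

lemma convolve_self_0:
  assumes "mollifier \<phi>" shows "convolve \<phi> \<phi> 0 = (\<integral>y. (\<phi> y)\<^sup>2 \<partial>lborel)"
  by (simp add: convolve_def mollifier_even[OF assms] power2_eq_square)

section \<open>Path kernels in space-time\<close>

abbreviation half_line :: "real measure" where
  "half_line \<equiv> restrict_space lborel {0..}"

lemma spacetime_eq: "spacetime = half_line \<Otimes>\<^sub>M lborel"
  by (simp add: spacetime_def)

lemma pair_sigma_finite_spacetime: "pair_sigma_finite half_line (lborel :: 'a::euclidean_space measure)"
proof -
  interpret sigma_finite_measure half_line
    by (intro sigma_finite_measure_restrict_space lborel.sigma_finite_measure_axioms) simp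
  show ?thesis by unfold_locales
qed

lemma path_at_continuous: "continuous_on {0..} (path_at \<omega>)"
  using path_at[of \<omega>] by simp

lemma path_at_measurable[measurable]: "path_at \<omega> \<in> borel_measurable half_line"
proof -
  have "sets half_line = sets (restrict_space borel {0..})"
    by (rule sets_restrict_space_cong) simp
  from measurable_cong_sets[OF this refl]
  show ?thesis using borel_measurable_continuous_on_restrict[OF path_at_continuous, of \<omega>] by blast
qed

lemma indicator_half_line[measurable]: "indicator {0..T} \<in> borel_measurable half_line"
  for T :: real
  by (intro measurable_restrict_space1) simp

lemma integral_indicator_half_line:
  assumes "0 \<le> T"
  shows "integrable half_line (indicator {0..T} :: real \<Rightarrow> real)"
    and "(\<integral>s. indicator {0..T} s \<partial>half_line) = T"
proof -
  have eq: "(\<lambda>s. indicat_real {0..} s * indicator {0..T} s) = (indicator {0..T} :: real \<Rightarrow> real)"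
    by (auto simp: indicator_def)
  have "integrable lborel (indicator {0..T} :: real \<Rightarrow> real)"
    by (rule integrable_real_indicator) (auto simp: emeasure_lborel_Icc_eq)
  then show "integrable half_line (indicator {0..T} :: real \<Rightarrow> real)"
    by (subst integrable_restrict_space) (simp_all add: eq)
  show "(\<integral>s. indicator {0..T} s \<partial>half_line) = T"
    using assms by (subst integral_restrict_space) (simp_all add: eq)
qed

lemma integrable_spacetimeI:
  fixes f :: "real \<times> 'a::euclidean_space \<Rightarrow> real"
  assumes [measurable]: "f \<in> borel_measurable spacetime" and "0 \<le> T"
    and le: "\<And>s. 0 \<le> s \<Longrightarrow> (\<integral>\<^sup>+y. ennreal \<bar>f (s, y)\<bar> \<partial>lborel) \<le> ennreal (C * indicator {0..T} s)"
  shows "integrable spacetime f"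
proof (rule integrableI_bounded)
  have "(\<integral>\<^sup>+z. ennreal (norm (f z)) \<partial>spacetime) = (\<integral>\<^sup>+s. \<integral>\<^sup>+y. ennreal \<bar>f (s, y)\<bar> \<partial>lborel \<partial>half_line)"
    unfolding spacetime_eq using assms(1)[unfolded spacetime_eq]
    by (subst lborel.nn_integral_fst[symmetric]) auto
  also have "\<dots> \<le> (\<integral>\<^sup>+s. ennreal (C * indicator {0..T} s) \<partial>half_line)"
    using le by (intro nn_integral_mono) (auto simp: space_restrict_space)
  \<comment> \<open>Passing to \<open>\<bar>C\<bar>\<close> makes the integrand nonnegative without
    an assumption on the sign of \<open>C\<close>.\<close>
  also have "\<dots> \<le> (\<integral>\<^sup>+s. ennreal (\<bar>C\<bar> * indicator {0..T} s) \<partial>half_line)"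
    by (intro nn_integral_mono ennreal_leI) (auto simp: indicator_def)
  also have "\<dots> = ennreal (\<integral>s. \<bar>C\<bar> * indicator {0..T} s \<partial>half_line)"
    using integral_indicator_half_line(1)[OF \<open>0 \<le> T\<close>] by (intro nn_integral_eq_integral) auto
  also have "\<dots> < \<infinity>" by simp
  finally show "(\<integral>\<^sup>+z. ennreal (norm (f z)) \<partial>spacetime) < \<infinity>" .
qed fact

lemma lborel_translate:
  fixes f :: "'a::euclidean_space \<Rightarrow> real"
  assumes [measurable]: "f \<in> borel_measurable borel"
  shows lborel_integral_translate: "(\<integral>y. f (c + y) \<partial>lborel) = (\<integral>y. f y \<partial>lborel)"
    and lborel_nn_integral_translate: "(\<integral>\<^sup>+y. ennreal (f (c + y)) \<partial>lborel) = (\<integral>\<^sup>+y. ennreal (f y) \<partial>lborel)"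
proof -
  have "(\<integral>y. f y \<partial>lborel) = (\<integral>y. f y \<partial>distr lborel borel ((+) c))"
    by (simp add: lborel_distr_plus)
  then show "(\<integral>y. f (c + y) \<partial>lborel) = (\<integral>y. f y \<partial>lborel)"
    by (simp add: integral_distr)
  have "(\<integral>\<^sup>+y. ennreal (f y) \<partial>lborel) = (\<integral>\<^sup>+y. ennreal (f y) \<partial>distr lborel borel ((+) c))"
    by (simp add: lborel_distr_plus)
  then show "(\<integral>\<^sup>+y. ennreal (f (c + y)) \<partial>lborel) = (\<integral>\<^sup>+y. ennreal (f y) \<partial>lborel)"
    by (simp add: nn_integral_distr)
qed

lemma mollifier_diff:
  assumes "mollifier \<phi>" shows "\<phi> (x - y) = \<phi> (- x + y)"
  using mollifier_even[OF assms, of "x - y"] by (simp add: algebra_simps)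

text \<open>The function to which the noise is applied in the Hamiltonian, so that covariances
  involving \<open>H T \<omega>\<close> become inner products with it.\<close>

definition path_kernel :: "('a::euclidean_space \<Rightarrow> real) \<Rightarrow> real \<Rightarrow> 'a cpath \<Rightarrow> real \<times> 'a \<Rightarrow> real" where
  "path_kernel \<phi> T \<omega> = (\<lambda>(s, y). indicator {0..T} s * \<phi> (path_at \<omega> s - y))"

definition window :: "real \<Rightarrow> ('a \<Rightarrow> real) \<Rightarrow> real \<times> 'a \<Rightarrow> real" where
  "window t g = (\<lambda>(s, y). indicator {0..t} s * g y)"

lemma path_kernel_measurable:
  assumes [measurable]: "\<phi> \<in> borel_measurable borel"
  shows "path_kernel \<phi> T \<omega> \<in> borel_measurable spacetime"
  unfolding path_kernel_def spacetime_eq by measurable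

lemma window_measurable:
  assumes [measurable]: "g \<in> borel_measurable borel"
  shows "window t g \<in> borel_measurable spacetime"
  unfolding window_def spacetime_eq by measurable

text \<open>At each time the spatial integral is translation invariant, so the path drops out of the
  norm. This is the constant variance required of a \<open>gaussian_field\<close>.\<close>

lemma path_kernel_square:
  assumes \<phi>: "mollifier \<phi>" and "0 \<le> T"
  shows "path_kernel \<phi> T \<omega> \<in> square_integrable spacetime"
    and "(\<integral>z. (path_kernel \<phi> T \<omega> z)\<^sup>2 \<partial>spacetime) = T * convolve \<phi> \<phi> 0"
proof -
  have [measurable]: "\<phi> \<in> borel_measurable borel" by (rule mollifier_measurable[OF \<phi>])
  note [measurable] = path_kernel_measurable[OF this]
  define c where "c = (\<integral>y. (\<phi> y)\<^sup>2 \<partial>lborel)"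
  have sq: "(path_kernel \<phi> T \<omega> (s, y))\<^sup>2 = indicator {0..T} s * (\<phi> (- path_at \<omega> s + y))\<^sup>2" for s y
    unfolding path_kernel_def case_prod_conv mollifier_diff[OF \<phi>, of "path_at \<omega> s" y]
    by (simp add: indicator_def)
  have nn: "(\<integral>\<^sup>+y. ennreal ((\<phi> (x + y))\<^sup>2) \<partial>lborel) = ennreal c" for x
    using lborel_nn_integral_translate[of "\<lambda>y. (\<phi> y)\<^sup>2" x]
      nn_integral_eq_integral[OF mollifier_integrable_square[OF \<phi>]] by (simp add: c_def)
  have tr: "(\<integral>y. (\<phi> (x + y))\<^sup>2 \<partial>lborel) = c" for x
    using lborel_integral_translate[of "\<lambda>y. (\<phi> y)\<^sup>2" x] by (simp add: c_def)
  have i: "integrable spacetime (\<lambda>z. (path_kernel \<phi> T \<omega> z)\<^sup>2)"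
  proof (rule integrable_spacetimeI[OF _ \<open>0 \<le> T\<close>, where C = c])
    fix s :: real
    show "(\<integral>\<^sup>+y. ennreal \<bar>(path_kernel \<phi> T \<omega> (s, y))\<^sup>2\<bar> \<partial>lborel) \<le> ennreal (c * indicator {0..T} s)"
      unfolding sq using nn[of "- path_at \<omega> s"] by (cases "s \<in> {0..T}") auto
  qed measurable
  then show "path_kernel \<phi> T \<omega> \<in> square_integrable spacetime"
    by (simp add: square_integrable_def path_kernel_measurable)
  interpret P: pair_sigma_finite half_line "lborel :: 'a measure" by (rule pair_sigma_finite_spacetime)
  have "(\<integral>z. (path_kernel \<phi> T \<omega> z)\<^sup>2 \<partial>spacetime)
    = (\<integral>s. \<integral>y. (path_kernel \<phi> T \<omega> (s, y))\<^sup>2 \<partial>lborel \<partial>half_line)"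
    using P.integral_fst'[OF i[unfolded spacetime_eq]] by (simp add: spacetime_eq)
  also have "\<dots> = (\<integral>s. indicator {0..T} s * c \<partial>half_line)"
    unfolding sq integral_mult_right_zero tr ..
  also have "\<dots> = T * c"
    using integral_indicator_half_line[OF \<open>0 \<le> T\<close>] by simp
  finally show "(\<integral>z. (path_kernel \<phi> T \<omega> z)\<^sup>2 \<partial>spacetime) = T * convolve \<phi> \<phi> 0"
    by (simp add: c_def convolve_self_0[OF \<phi>])
qed

lemma window_square_integrable:
  assumes [measurable]: "g \<in> borel_measurable borel" and g: "integrable lborel (\<lambda>y. (g y)\<^sup>2)" and "0 \<le> t"
  shows "window t g \<in> square_integrable spacetime"
proof -
  note [measurable] = window_measurable[OF assms(1)]
  have "integrable spacetime (\<lambda>z. (window t g z)\<^sup>2)"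
  proof (rule integrable_spacetimeI[OF _ \<open>0 \<le> t\<close>, where C = "\<integral>y. (g y)\<^sup>2 \<partial>lborel"])
    fix s :: real
    show "(\<integral>\<^sup>+y. ennreal \<bar>(window t g (s, y))\<^sup>2\<bar> \<partial>lborel) \<le> ennreal ((\<integral>y. (g y)\<^sup>2 \<partial>lborel) * indicator {0..t} s)"
      using nn_integral_eq_integral[OF g] by (cases "s \<in> {0..t}") (auto simp: window_def)
  qed measurable
  then show ?thesis by (simp add: square_integrable_def window_measurable)
qed

text \<open>For \<open>t \<le> T\<close> the two time indicators multiply to that of
  \<open>{0..t}\<close>, so the value does not depend on \<open>T\<close>. This is why the tested
  masses form a constant sequence.\<close>

lemma integral_window_path_kernel:
  fixes \<phi> g :: "'a::euclidean_space \<Rightarrow> real"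
  assumes \<phi>: "mollifier \<phi>" and gm[measurable]: "g \<in> borel_measurable borel"
    and g: "integrable lborel g" and "0 \<le> t" "t \<le> T"
  shows "integrable half_line (\<lambda>s. indicator {0..t} s * (\<integral>y. g y * \<phi> (path_at \<omega> s - y) \<partial>lborel))"
    and "(\<integral>z. window t g z * path_kernel \<phi> T \<omega> z \<partial>spacetime)
      = (\<integral>s. indicator {0..t} s * (\<integral>y. g y * \<phi> (path_at \<omega> s - y) \<partial>lborel) \<partial>half_line)"
proof -
  have [measurable]: "\<phi> \<in> borel_measurable borel" by (rule mollifier_measurable[OF \<phi>])
  note [measurable] = path_kernel_measurable[OF this] window_measurable[OF gm]
  obtain C where C: "0 \<le> C" "\<And>x. \<bar>\<phi> x\<bar> \<le> C" using mollifier_bounded[OF \<phi>] by blast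
  have eq: "window t g (s, y) * path_kernel \<phi> T \<omega> (s, y) = indicator {0..t} s * (g y * \<phi> (path_at \<omega> s - y))" for s y
    using assms by (auto simp: window_def path_kernel_def indicator_def)
  have i: "integrable spacetime (\<lambda>z. window t g z * path_kernel \<phi> T \<omega> z)"
  proof (rule integrable_spacetimeI[OF _ \<open>0 \<le> t\<close>, where C = "\<integral>y. C * \<bar>g y\<bar> \<partial>lborel"])
    fix s :: real
    have "(\<integral>\<^sup>+y. ennreal \<bar>g y * \<phi> (path_at \<omega> s - y)\<bar> \<partial>lborel) \<le> (\<integral>\<^sup>+y. ennreal (C * \<bar>g y\<bar>) \<partial>lborel)"
      unfolding abs_mult mult.commute[of C] using C by (intro nn_integral_mono ennreal_leI mult_left_mono) auto
    also have "\<dots> = ennreal (\<integral>y. C * \<bar>g y\<bar> \<partial>lborel)"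
      using g C by (intro nn_integral_eq_integral) auto
    finally show "(\<integral>\<^sup>+y. ennreal \<bar>window t g (s, y) * path_kernel \<phi> T \<omega> (s, y)\<bar> \<partial>lborel)
      \<le> ennreal ((\<integral>y. C * \<bar>g y\<bar> \<partial>lborel) * indicator {0..t} s)"
      unfolding eq by (cases "s \<in> {0..t}") auto
  qed measurable
  interpret P: pair_sigma_finite half_line "lborel :: 'a measure" by (rule pair_sigma_finite_spacetime)
  have eq': "(\<integral>y. window t g (s, y) * path_kernel \<phi> T \<omega> (s, y) \<partial>lborel)
    = indicator {0..t} s * (\<integral>y. g y * \<phi> (path_at \<omega> s - y) \<partial>lborel)" for s
    unfolding eq by simp
  show "integrable half_line (\<lambda>s. indicator {0..t} s * (\<integral>y. g y * \<phi> (path_at \<omega> s - y) \<partial>lborel))"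
    using P.integrable_fst'[OF i[unfolded spacetime_eq]] unfolding eq' .
  show "(\<integral>z. window t g z * path_kernel \<phi> T \<omega> z \<partial>spacetime)
      = (\<integral>s. indicator {0..t} s * (\<integral>y. g y * \<phi> (path_at \<omega> s - y) \<partial>lborel) \<partial>half_line)"
    using P.integral_fst'[OF i[unfolded spacetime_eq]] unfolding eq' by (simp add: spacetime_eq)
qed

section \<open>The limiting masses tested against the noise\<close>

lemma hamiltonian_version_section:
  fixes H :: "real \<Rightarrow> 'a::euclidean_space cpath \<Rightarrow> 'e \<Rightarrow> real"
  assumes "hamiltonian_version M B \<phi> H" "0 \<le> T"
  shows "AE e in M. H T \<omega> e = B (path_kernel \<phi> T \<omega>) e"
    and "case_prod (H T) \<in> borel_measurable (borel \<Otimes>\<^sub>M M)"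
proof -
  show "AE e in M. H T \<omega> e = B (path_kernel \<phi> T \<omega>) e"
    using assms unfolding hamiltonian_version_def path_kernel_def by blast
  have H: "(\<lambda>(T, \<omega>, e). H T \<omega> e) \<in> borel_measurable (restrict_space borel {0..} \<Otimes>\<^sub>M borel \<Otimes>\<^sub>M M)"
    using assms unfolding hamiltonian_version_def by blast
  have "Pair T \<in> (borel \<Otimes>\<^sub>M M) \<rightarrow>\<^sub>M (restrict_space borel {0..} \<Otimes>\<^sub>M borel \<Otimes>\<^sub>M M)"
    using assms(2) by (intro measurable_Pair1') (simp add: space_restrict_space)
  from measurable_compose[OF this H] show "case_prod (H T) \<in> borel_measurable (borel \<Otimes>\<^sub>M M)"
    by (simp add: case_prod_beta')
qed

context
  fixes M :: "'e measure" and W :: "'a::euclidean_space cpath measure"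
    and B :: "(real \<times> 'a \<Rightarrow> real) \<Rightarrow> 'e \<Rightarrow> real"
    and \<phi> :: "'a \<Rightarrow> real" and H :: "real \<Rightarrow> 'a cpath \<Rightarrow> 'e \<Rightarrow> real"
  assumes M: "prob_space M" and W: "wiener_measure W" and B: "white_noise M B"
    and \<phi>: "mollifier \<phi>" and H: "hamiltonian_version M B \<phi> H"
begin

lemma wiener_facts: "prob_space W" "sets W = sets borel" "space W = UNIV"
  using W sets_eq_imp_space_eq[of W borel] by (auto simp: wiener_measure_def)

lemma hamiltonian_measurable:
  assumes "0 \<le> T" shows "case_prod (H T) \<in> borel_measurable (W \<Otimes>\<^sub>M M)"
proof -
  have "sets (W \<Otimes>\<^sub>M M) = sets (borel \<Otimes>\<^sub>M M)"
    by (intro sets_pair_measure_cong wiener_facts refl)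
  from measurable_cong_sets[OF this refl] hamiltonian_version_section(2)[OF H assms]
  show ?thesis by blast
qed

lemma hamiltonian_section_measurable: "0 \<le> T \<Longrightarrow> H T \<omega> \<in> borel_measurable M"
  by (rule measurable_section[OF hamiltonian_measurable wiener_facts(3)])

lemma hamiltonian_field:
  assumes "0 \<le> T"
  shows "gaussian_field W M (H T) (T * convolve \<phi> \<phi> 0)"
proof -
  interpret W: prob_space W by (rule wiener_facts)
  interpret M: prob_space M by (rule M)
  have ae: "AE e in M. H T \<omega> e = B (path_kernel \<phi> T \<omega>) e" for \<omega>
    by (rule hamiltonian_version_section(1)[OF H assms])
  have ae': "AE e in M. B (path_kernel \<phi> T \<omega>) e = H T \<omega> e" for \<omega>
    using ae[of \<omega>] by eventually_elim simp
  note L2 = path_kernel_square(1)[OF \<phi> assms]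
  have Hm: "H T \<omega> \<in> borel_measurable M" for \<omega> by (rule hamiltonian_section_measurable[OF assms])
  show ?thesis
  proof
    show "centered_gaussian M (\<lambda>e. l (\<lambda>w. H T w e))" if l: "linear_form l" for l
    proof -
      obtain J c where J: "finite J" "l = (\<lambda>x. \<Sum>i\<in>J. c i * x i)"
        using l by (auto simp: linear_form_def)
      \<comment> \<open>The exceptional null set depends on the path; a linear form meets only
        finitely many paths, so these sets can be united.\<close>
      have "AE e in M. \<forall>\<omega>\<in>J. B (path_kernel \<phi> T \<omega>) e = H T \<omega> e"
        by (rule AE_finite_allI[OF J(1) ae'])
      then have "AE e in M. (\<Sum>\<omega>\<in>J. c \<omega> * B (path_kernel \<phi> T \<omega>) e) = (\<Sum>\<omega>\<in>J. c \<omega> * H T \<omega> e)"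
        by eventually_elim (rule sum.cong, simp_all)
      moreover have "centered_gaussian M (\<lambda>e. \<Sum>\<omega>\<in>J. c \<omega> * B (path_kernel \<phi> T \<omega>) e)"
        by (rule white_noise_sum_gaussian[OF B J(1)]) (rule L2)
      moreover have "(\<lambda>e. \<Sum>\<omega>\<in>J. c \<omega> * H T \<omega> e) \<in> borel_measurable M"
        using Hm by measurable
      ultimately show ?thesis
        unfolding J(2) by (rule centered_gaussian_cong_AE[rotated 2])
    qed
    fix \<omega>
    have [measurable]: "B (path_kernel \<phi> T \<omega>) \<in> borel_measurable M"
      using white_noise_gaussian[OF B L2] by (simp add: centered_gaussian_def)
    note [measurable] = Hm
    have "(\<integral>e. (H T \<omega> e)\<^sup>2 \<partial>M) = (\<integral>e. B (path_kernel \<phi> T \<omega>) e * B (path_kernel \<phi> T \<omega>) e \<partial>M)"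
      by (intro integral_cong_AE, measurable, use ae[of \<omega>] in eventually_elim) (simp add: power2_eq_square)
    also have "\<dots> = (\<integral>z. path_kernel \<phi> T \<omega> z * path_kernel \<phi> T \<omega> z \<partial>spacetime)"
      using B L2 unfolding white_noise_def by blast
    also have "\<dots> = T * convolve \<phi> \<phi> 0"
      using path_kernel_square(2)[OF \<phi> assms] by (simp add: power2_eq_square)
    finally show "(\<integral>e. (H T \<omega> e)\<^sup>2 \<partial>M) = T * convolve \<phi> \<phi> 0" .
  qed (use wiener_facts hamiltonian_measurable[OF assms] in auto)
qed

text \<open>The equality holds at every \<open>e\<close> of the space: where the total mass is
  infinite, \<open>measure\<close> and the Bochner integral both give 0.\<close>

lemma measure_gmc:
  assumes "0 \<le> T" "e \<in> space M"
  shows "measure (gmc W \<phi> H \<gamma> T e) UNIV = gaussian_field.mass W (H T) (T * convolve \<phi> \<phi> 0) \<gamma> e"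
proof -
  interpret gaussian_field W M "H T" "T * convolve \<phi> \<phi> 0" by (rule hamiltonian_field[OF assms(1)])
  have [measurable]: "(\<lambda>\<omega>. H T \<omega> e) \<in> borel_measurable W"
    using measurable_compose[OF measurable_Pair2'[OF assms(2)] K] by simp
  have "emeasure (gmc W \<phi> H \<gamma> T e) UNIV
    = (\<integral>\<^sup>+\<omega>. ennreal (exp (\<gamma> * H T \<omega> e - \<gamma>\<^sup>2 / 2 * T * convolve \<phi> \<phi> 0)) \<partial>W)"
    unfolding gmc_def using sets.top[of W] wiener_facts(3)
    by (subst emeasure_density) (auto intro!: nn_integral_cong)
  then show ?thesis
    unfolding mass_def by (simp add: measure_def integral_eq_nn_integral mult.assoc)
qed

lemma uniformly_integrable_excess:
  assumes "uniformly_integrable M {0..} (\<lambda>T e. measure (gmc W \<phi> H b T e) UNIV)" "0 < \<epsilon>"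
  shows "\<exists>k. \<forall>T\<ge>0. (\<integral>e. max 0 (gaussian_field.mass W (H T) (T * convolve \<phi> \<phi> 0) b e - k) \<partial>M) \<le> \<epsilon>"
proof -
  interpret M: prob_space M by (rule M)
  let ?Z = "\<lambda>T e. measure (gmc W \<phi> H b T e) UNIV"
  obtain k where k: "\<And>T. 0 \<le> T \<Longrightarrow> (\<integral>e. \<bar>?Z T e\<bar> * indicator {e. \<bar>?Z T e\<bar> > k} e \<partial>M) \<le> \<epsilon>"
    using assms unfolding uniformly_integrable_def by (meson atLeast_iff)
  \<comment> \<open>The level in the definition of uniform integrability may be negative. The excess
    is dominated by the tail integrand once the level is raised to at least 0.\<close>
  have "(\<integral>e. max 0 (gaussian_field.mass W (H T) (T * convolve \<phi> \<phi> 0) b e - max 0 k) \<partial>M) \<le> \<epsilon>"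
    if T: "0 \<le> T" for T
  proof -
    have iZ: "integrable M (?Z T)" using assms T unfolding uniformly_integrable_def by auto
    then have [measurable]: "?Z T \<in> borel_measurable M" by blast
    have ind: "(\<lambda>e. indicator {e. \<bar>?Z T e\<bar> > k} e :: real) = (\<lambda>e. if \<bar>?Z T e\<bar> > k then 1 else 0)"
      by (auto simp: indicator_def)
    have "(\<integral>e. max 0 (gaussian_field.mass W (H T) (T * convolve \<phi> \<phi> 0) b e - max 0 k) \<partial>M)
      = (\<integral>e. max 0 (?Z T e - max 0 k) \<partial>M)"
      by (intro Bochner_Integration.integral_cong) (auto simp: measure_gmc[OF T])
    also have "\<dots> \<le> (\<integral>e. \<bar>?Z T e\<bar> * indicator {e. \<bar>?Z T e\<bar> > k} e \<partial>M)"
    proof (rule integral_mono)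
      show "integrable M (\<lambda>e. max 0 (?Z T e - max 0 k))"
        using iZ by (intro integrable_max) auto
      show "integrable M (\<lambda>e. \<bar>?Z T e\<bar> * indicator {e. \<bar>?Z T e\<bar> > k} e)"
        unfolding ind by (rule Bochner_Integration.integrable_bound[OF iZ]) auto
      show "max 0 (?Z T e - max 0 k) \<le> \<bar>?Z T e\<bar> * indicator {e. \<bar>?Z T e\<bar> > k} e" for e
        by (auto simp: indicator_def)
    qed
    also have "\<dots> \<le> \<epsilon>" by (rule k[OF T])
    finally show ?thesis .
  qed
  then show ?thesis by blast
qed

text \<open>The comparison of parameters holds for each \<open>T\<close> and each level
  \<open>k\<close> separately, so a level that serves all \<open>T\<close> at some \<open>b\<close>
  above \<gamma> serves all \<open>T\<close> at \<gamma>.\<close>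

lemma critical_parameter_excess:
  assumes "0 < \<gamma>" "ereal \<gamma> < critical_parameter M W \<phi> H" "0 < \<epsilon>"
  shows "\<exists>k. \<forall>T\<ge>0. (\<integral>e. max 0 (gaussian_field.mass W (H T) (T * convolve \<phi> \<phi> 0) \<gamma> e - k) \<partial>M) \<le> \<epsilon>"
proof -
  obtain b where b: "\<gamma> < b" "uniformly_integrable M {0..} (\<lambda>T e. measure (gmc W \<phi> H b T e) UNIV)"
    using assms(2) unfolding critical_parameter_def less_Sup_iff by auto
  obtain k where k: "\<And>T. 0 \<le> T \<Longrightarrow>
    (\<integral>e. max 0 (gaussian_field.mass W (H T) (T * convolve \<phi> \<phi> 0) b e - k) \<partial>M) \<le> \<epsilon>"
    using uniformly_integrable_excess[OF b(2) assms(3)] by blast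
  have "(\<integral>e. max 0 (gaussian_field.mass W (H T) (T * convolve \<phi> \<phi> 0) \<gamma> e - k) \<partial>M) \<le> \<epsilon>" if "0 \<le> T" for T
    using gaussian_field.excess_mass_mono[OF hamiltonian_field[OF that], of \<gamma> b k] k[OF that] assms(1) b(1)
    by simp
  then show ?thesis by blast
qed

lemma hamiltonian_noise_gaussian:
  assumes "0 \<le> T" and f: "f \<in> square_integrable spacetime"
  shows "centered_gaussian M (\<lambda>e. a * B f e + b * H T \<omega> e)"
    and "(\<integral>e. B f e * H T \<omega> e \<partial>M) = (\<integral>z. f z * path_kernel \<phi> T \<omega> z \<partial>spacetime)"
proof -
  have ae: "AE e in M. H T \<omega> e = B (path_kernel \<phi> T \<omega>) e"
    by (rule hamiltonian_version_section(1)[OF H assms(1)])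
  note L2 = path_kernel_square(1)[OF \<phi> assms(1)]
  have [measurable]: "H T \<omega> \<in> borel_measurable M" "B f \<in> borel_measurable M"
    "B (path_kernel \<phi> T \<omega>) \<in> borel_measurable M"
    using hamiltonian_section_measurable[OF assms(1)] white_noise_gaussian[OF B f]
      white_noise_gaussian[OF B L2] by (auto simp: centered_gaussian_def)
  \<comment> \<open>Indexing by truth values keeps the two terms apart even when \<open>f\<close>
    coincides with the kernel.\<close>
  have "centered_gaussian M (\<lambda>e. \<Sum>j\<in>{True, False}. (if j then a else b) * B (if j then f else path_kernel \<phi> T \<omega>) e)"
    using f L2 by (intro white_noise_sum_gaussian[OF B]) auto
  then show "centered_gaussian M (\<lambda>e. a * B f e + b * H T \<omega> e)"
    by (rule centered_gaussian_cong_AE) (measurable, use ae in eventually_elim, simp)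
  have "(\<integral>e. B f e * H T \<omega> e \<partial>M) = (\<integral>e. B f e * B (path_kernel \<phi> T \<omega>) e \<partial>M)"
    by (intro integral_cong_AE, measurable, use ae in eventually_elim) simp
  also have "\<dots> = (\<integral>z. f z * path_kernel \<phi> T \<omega> z \<partial>spacetime)"
    using B f L2 unfolding white_noise_def by blast
  finally show "(\<integral>e. B f e * H T \<omega> e \<partial>M) = (\<integral>z. f z * path_kernel \<phi> T \<omega> z \<partial>spacetime)" .
qed

lemma sin_noise_mass:
  fixes \<gamma> :: real
  assumes "0 \<le> T" and f: "f \<in> square_integrable spacetime"
  defines "F \<equiv> \<lambda>\<omega>. sin (\<gamma> * (\<integral>z. f z * path_kernel \<phi> T \<omega> z \<partial>spacetime))"
  shows "F \<in> borel_measurable W"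
    and "(\<integral>e. sin (B f e) * gaussian_field.mass W (H T) (T * convolve \<phi> \<phi> 0) \<gamma> e \<partial>M)
      = exp (- (\<integral>z. (f z)\<^sup>2 \<partial>spacetime) / 2) * (\<integral>\<omega>. F \<omega> \<partial>W)"
proof -
  interpret gaussian_field W M "H T" "T * convolve \<phi> \<phi> 0" by (rule hamiltonian_field[OF assms(1)])
  interpret P: pair_prob_space W M ..
  define v where "v = T * convolve \<phi> \<phi> 0"
  define q where "q = (\<integral>z. (f z)\<^sup>2 \<partial>spacetime)"
  define \<kappa> where "\<kappa> = exp (- (\<gamma>\<^sup>2 / 2 * v))"
  have [measurable]: "B f \<in> borel_measurable M"
    using white_noise_gaussian[OF B f] by (simp add: centered_gaussian_def)
  have Bq: "(\<integral>e. (B f e)\<^sup>2 \<partial>M) = q"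
    using B f unfolding white_noise_def q_def power2_eq_square by blast
  have inner: "\<kappa> * (\<integral>e. sin (B f e) * exp (\<gamma> * H T \<omega> e) \<partial>M) = exp (- q / 2) * F \<omega>" for \<omega>
  proof -
    have g: "centered_gaussian M (\<lambda>e. a * B f e + b * (\<gamma> * H T \<omega> e))" for a b
      using hamiltonian_noise_gaussian(1)[OF assms(1) f, of a "b * \<gamma>" \<omega>] by (simp add: mult.assoc)
    have "(\<integral>e. (\<gamma> * H T \<omega> e)\<^sup>2 \<partial>M) = \<gamma>\<^sup>2 * v"
      using variance[of \<omega>] by (simp add: power_mult_distrib v_def)
    moreover have "(\<integral>e. B f e * (\<gamma> * H T \<omega> e) \<partial>M) = \<gamma> * (\<integral>z. f z * path_kernel \<phi> T \<omega> z \<partial>spacetime)"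
      using hamiltonian_noise_gaussian(2)[OF assms(1) f, of \<omega>] by (simp add: mult.left_commute[of _ \<gamma>])
    ultimately have "(\<integral>e. sin (B f e) * exp (\<gamma> * H T \<omega> e) \<partial>M) = exp ((\<gamma>\<^sup>2 * v - q) / 2) * F \<omega>"
      unfolding F_def using gaussian_pair_sin_exp[OF M g] Bq by simp
    \<comment> \<open>The normalisation cancels the variance of
      \<open>\<gamma> * H T \<omega> e\<close>, leaving only the norm of \<open>f\<close> in the
      exponent.\<close>
    moreover have "- (\<gamma>\<^sup>2 / 2 * v) + (\<gamma>\<^sup>2 * v - q) / 2 = - q / 2" by (simp add: field_simps)
    ultimately show ?thesis
      unfolding \<kappa>_def by (simp only: mult.assoc[symmetric] exp_add[symmetric])
  qed
  have i: "integrable (W \<Otimes>\<^sub>M M) (\<lambda>(\<omega>, e). sin (B f e) * exp (\<gamma> * H T \<omega> e))"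
    by (rule Bochner_Integration.integrable_bound[OF integrable_pair_exp[of \<gamma>]])
      (auto intro!: AE_I2 simp: abs_mult mult_left_le_one_le)
  \<comment> \<open>Measurability of \<open>F\<close> in the path is read off from this
    representation as a partial integral of a jointly measurable function.\<close>
  have F: "F = (\<lambda>\<omega>. exp (q / 2) * (\<kappa> * (\<integral>e. sin (B f e) * exp (\<gamma> * H T \<omega> e) \<partial>M)))"
    unfolding inner by (auto simp: mult.assoc[symmetric] exp_add[symmetric])
  show "F \<in> borel_measurable W"
    unfolding F using P.integrable_fst[OF i] by (intro borel_measurable_times borel_measurable_const) blast
  have pointwise: "sin (B f e) * mass \<gamma> e = \<kappa> * (\<integral>\<omega>. sin (B f e) * exp (\<gamma> * H T \<omega> e) \<partial>W)" for e
    unfolding mass_eq \<kappa>_def v_def by (simp add: mult.left_commute)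
  have "(\<integral>e. sin (B f e) * mass \<gamma> e \<partial>M) = \<kappa> * (\<integral>e. \<integral>\<omega>. sin (B f e) * exp (\<gamma> * H T \<omega> e) \<partial>W \<partial>M)"
    unfolding pointwise by simp
  also have "\<dots> = \<kappa> * (\<integral>\<omega>. \<integral>e. sin (B f e) * exp (\<gamma> * H T \<omega> e) \<partial>M \<partial>W)"
    using P.Fubini_integral[OF i] by simp
  also have "\<dots> = (\<integral>\<omega>. \<kappa> * (\<integral>e. sin (B f e) * exp (\<gamma> * H T \<omega> e) \<partial>M) \<partial>W)"
    by simp
  also have "\<dots> = exp (- q / 2) * (\<integral>\<omega>. F \<omega> \<partial>W)"
    unfolding inner by simp
  finally show "(\<integral>e. sin (B f e) * mass \<gamma> e \<partial>M) = exp (- (\<integral>z. (f z)\<^sup>2 \<partial>spacetime) / 2) * (\<integral>\<omega>. F \<omega> \<partial>W)"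
    by (simp add: q_def)
qed

lemma sin_noise_limit_mass:
  assumes "0 < \<gamma>" "ereal \<gamma> < critical_parameter M W \<phi> H" and \<mu>: "gmc_limit M W \<phi> H \<gamma> \<mu>"
    and g: "g \<in> borel_measurable borel" "integrable lborel g" "integrable lborel (\<lambda>y. (g y)\<^sup>2)" and "0 \<le> t"
  shows "(\<integral>e. sin (B (window t g) e) * measure (\<mu> e) UNIV \<partial>M)
      = exp (- (\<integral>z. (window t g z)\<^sup>2 \<partial>spacetime) / 2)
        * (\<integral>\<omega>. sin (\<gamma> * (\<integral>z. window t g z * path_kernel \<phi> t \<omega> z \<partial>spacetime)) \<partial>W)"
proof (rule excess_bounded_integral_limit[OF M])
  \<comment> \<open>The times start at \<open>t\<close>, so that the whole window lies in the range
    of the kernel for every \<open>n\<close>.\<close>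
  let ?T = "\<lambda>n. t + real n"
  let ?Z = "\<lambda>n. gaussian_field.mass W (H (?T n)) (?T n * convolve \<phi> \<phi> 0) \<gamma>"
  have T: "0 \<le> ?T n" "t \<le> ?T n" for n using \<open>0 \<le> t\<close> by auto
  have L2: "window t g \<in> square_integrable spacetime"
    by (rule window_square_integrable[OF g(1,3) \<open>0 \<le> t\<close>])
  show "integrable M (?Z n)" for n
  proof -
    interpret gaussian_field W M "H (?T n)" "?T n * convolve \<phi> \<phi> 0" by (rule hamiltonian_field[OF T(1)])
    interpret P: pair_prob_space W M ..
    show ?thesis unfolding mass_eq using P.integrable_snd[OF integrable_pair_exp[of \<gamma>]] by simp
  qed
  show "0 \<le> ?Z n e" for n e
    unfolding gaussian_field.mass_def[OF hamiltonian_field[OF T(1)]] by (intro Bochner_Integration.integral_nonneg) simp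
  have rm: "random_measure M \<mu>" using \<mu> by (simp add: gmc_limit_def)
  then show "(\<lambda>e. measure (\<mu> e) UNIV) \<in> borel_measurable M"
    unfolding random_measure_def measure_def by (auto intro!: borel_measurable_enn2real)
  have "AE e in M. weakly_converges at_top (\<lambda>T. gmc W \<phi> H \<gamma> T e) (\<mu> e)"
    using \<mu> by (simp add: gmc_limit_def)
  then show "AE e in M. (\<lambda>n. ?Z n e) \<longlonglongrightarrow> measure (\<mu> e) UNIV"
    using AE_space
  proof eventually_elim
    case (elim e)
    have sp: "space (\<mu> e) = UNIV"
      using rm elim(2) sets_eq_imp_space_eq[of "\<mu> e" borel] by (auto simp: random_measure_def)
    have sp': "space (gmc W \<phi> H \<gamma> T e) = UNIV" for T
      by (simp add: gmc_def wiener_facts)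
    \<comment> \<open>Total masses converge because the constant 1 is an admissible test function
      for weak convergence.\<close>
    have one: "continuous_on UNIV (\<lambda>_ :: 'a cpath. 1 :: real) \<and> bounded (range (\<lambda>_ :: 'a cpath. 1 :: real))"
      by simp
    have "((\<lambda>T. \<integral>\<omega>. (1::real) \<partial>gmc W \<phi> H \<gamma> T e) \<longlongrightarrow> (\<integral>\<omega>. 1 \<partial>\<mu> e)) at_top"
      using elim(1) one unfolding weakly_converges_def by blast
    then have "((\<lambda>T. measure (gmc W \<phi> H \<gamma> T e) UNIV) \<longlongrightarrow> measure (\<mu> e) UNIV) at_top"
      by (simp add: sp sp')
    moreover have "filterlim ?T at_top sequentially"
      by (rule filterlim_tendsto_add_at_top[OF tendsto_const filterlim_real_sequentially])
    ultimately have "(\<lambda>n. measure (gmc W \<phi> H \<gamma> (?T n) e) UNIV) \<longlonglongrightarrow> measure (\<mu> e) UNIV"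
      by (rule filterlim_compose)
    then show ?case using elim(2) T by (simp add: measure_gmc)
  qed
  show "\<exists>k. \<forall>n. (\<integral>e. max 0 (?Z n e - k) \<partial>M) \<le> \<epsilon>" if "0 < \<epsilon>" for \<epsilon>
    using critical_parameter_excess[OF assms(1,2) that] T by blast
  show "(\<lambda>e. sin (B (window t g) e)) \<in> borel_measurable M"
    using white_noise_gaussian[OF B L2] by (auto simp: centered_gaussian_def)
  show "(\<integral>e. sin (B (window t g) e) * ?Z n e \<partial>M)
    = exp (- (\<integral>z. (window t g z)\<^sup>2 \<partial>spacetime) / 2)
        * (\<integral>\<omega>. sin (\<gamma> * (\<integral>z. window t g z * path_kernel \<phi> t \<omega> z \<partial>spacetime)) \<partial>W)" for n
    unfolding sin_noise_mass(2)[OF T(1) L2]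
      integral_window_path_kernel(2)[OF \<phi> g(1,2) \<open>0 \<le> t\<close> T(2)]
      integral_window_path_kernel(2)[OF \<phi> g(1,2) \<open>0 \<le> t\<close> order_refl] ..
qed auto

text \<open>With \<open>h\<close> the convolution of \<open>g\<close> and \<phi>, the inner product
  divided by \<open>t n\<close> is the time average of \<open>h\<close> along the path over
  \<open>{0..t n}\<close>. It tends to \<open>h 0\<close> by continuity of \<open>h\<close> and of
  paths, which almost surely start at 0; evenness of \<phi> identifies \<open>h 0\<close>.\<close>

lemma sin_window_small_time:
  assumes g: "g \<in> borel_measurable borel" "integrable lborel g" "integrable lborel (\<lambda>y. (g y)\<^sup>2)"
  defines "t \<equiv> \<lambda>n. 1 / real (Suc n)"
  shows "(\<lambda>n. (\<integral>\<omega>. sin (\<gamma> * (\<integral>z. window (t n) g z * path_kernel \<phi> (t n) \<omega> z \<partial>spacetime)) \<partial>W) / t n)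
    \<longlonglongrightarrow> \<gamma> * (\<integral>y. g y * \<phi> y \<partial>lborel)"
proof -
  interpret W: prob_space W by (rule wiener_facts)
  have t: "0 < t n" for n by (simp add: t_def)
  define h where "h x = (\<integral>y. g y * \<phi> (x - y) \<partial>lborel)" for x
  obtain C where C: "0 \<le> C" "\<And>x. \<bar>\<phi> x\<bar> \<le> C" using mollifier_bounded[OF \<phi>] by blast
  have \<phi>m[measurable]: "\<phi> \<in> borel_measurable borel" by (rule mollifier_measurable[OF \<phi>])
  note [measurable] = g(1)
  have le: "\<bar>g y * \<phi> (x - y)\<bar> \<le> C * \<bar>g y\<bar>" for x y
    unfolding abs_mult mult.commute[of C] using C by (intro mult_left_mono) auto
  \<comment> \<open>A uniform bound for \<open>h\<close>. It dominates the quotients by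
    \<open>\<bar>\<gamma>\<bar> * D\<close> and controls the error of replacing the sine by its
    argument.\<close>
  define D where "D = (\<integral>y. C * \<bar>g y\<bar> \<partial>lborel)"
  have hD: "\<bar>h x\<bar> \<le> D" for x
  proof -
    have i: "integrable lborel (\<lambda>y. C * \<bar>g y\<bar>)" using g(2) by auto
    then have "integrable lborel (\<lambda>y. g y * \<phi> (x - y))"
      by (rule Bochner_Integration.integrable_bound) (use le C in \<open>auto intro!: AE_I2 simp: abs_mult\<close>)
    then show ?thesis
      unfolding h_def D_def using i le
      by (intro order_trans[OF integral_abs_bound] integral_mono integrable_abs)
  qed
  \<comment> \<open>Continuity is checked along sequences so that dominated convergence, with
    majorant \<open>C * \<bar>g y\<bar>\<close>, applies.\<close>
  have hc: "isCont h 0"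
    unfolding isCont_def
  proof (rule tendsto_at_iff_sequentially[THEN iffD2], intro allI impI)
    fix X :: "nat \<Rightarrow> 'a" assume X: "\<forall>i. X i \<in> UNIV - {0}" "X \<longlonglongrightarrow> 0"
    have "(\<lambda>n. h (X n)) \<longlonglongrightarrow> h 0"
      unfolding h_def
    proof (rule integral_dominated_convergence[where w = "\<lambda>y. C * \<bar>g y\<bar>"])
      have "isCont \<phi> z" for z
        using mollifier_continuous[OF \<phi>] by (simp add: continuous_on_eq_continuous_at)
      then have "(\<lambda>n. \<phi> (X n - y)) \<longlonglongrightarrow> \<phi> (0 - y)" for y
        by (intro isCont_tendsto_compose[of _ \<phi>] tendsto_diff X(2) tendsto_const)
      then show "AE y in lborel. (\<lambda>n. g y * \<phi> (X n - y)) \<longlonglongrightarrow> g y * \<phi> (0 - y)"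
        by (intro AE_I2 tendsto_mult tendsto_const)
      show "AE y in lborel. norm (g y * \<phi> (X n - y)) \<le> C * \<bar>g y\<bar>" for n
        using le by (intro AE_I2) (simp only: real_norm_def)
    qed (use g(2) in auto)
    then show "(h \<circ> X) \<longlonglongrightarrow> h 0" by (simp add: comp_def)
  qed
  define F where "F n \<omega> = (\<integral>z. window (t n) g z * path_kernel \<phi> (t n) \<omega> z \<partial>spacetime)" for n \<omega>
  note ind = integral_indicator_half_line[OF less_imp_le[OF t]]
  have Fh: "F n \<omega> = (\<integral>s. indicator {0..t n} s * h (path_at \<omega> s) \<partial>half_line)"
    and iFh: "integrable half_line (\<lambda>s. indicator {0..t n} s * h (path_at \<omega> s))" for n \<omega>
    using integral_window_path_kernel[OF \<phi> g(1,2) less_imp_le[OF t] order_refl]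
    unfolding F_def h_def by auto
  \<comment> \<open>Used with \<open>c = h 0\<close> for the limit, and with \<open>c = 0\<close>
    and \<open>\<delta> = D\<close> for the uniform bound \<open>FD\<close>.\<close>
  have diff: "\<bar>F n \<omega> - t n * c\<bar> \<le> t n * \<delta>"
    if "\<And>s. s \<in> {0..t n} \<Longrightarrow> \<bar>h (path_at \<omega> s) - c\<bar> \<le> \<delta>" for n \<omega> c \<delta>
  proof -
    have "F n \<omega> - t n * c = (\<integral>s. indicator {0..t n} s * h (path_at \<omega> s) - indicator {0..t n} s * c \<partial>half_line)"
      using iFh ind by (simp add: Fh)
    also have "\<bar>\<dots>\<bar> \<le> (\<integral>s. indicator {0..t n} s * \<delta> \<partial>half_line)"
    proof (rule order_trans[OF integral_abs_bound], rule integral_mono)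
      show "integrable half_line (\<lambda>s. \<bar>indicator {0..t n} s * h (path_at \<omega> s) - indicator {0..t n} s * c\<bar>)"
        using iFh ind by (intro integrable_abs Bochner_Integration.integrable_diff) auto
      show "integrable half_line (\<lambda>s. indicator {0..t n} s * \<delta>)" using ind by auto
      show "\<bar>indicator {0..t n} s * h (path_at \<omega> s) - indicator {0..t n} s * c\<bar> \<le> indicator {0..t n} s * \<delta>" for s
        using that[of s] by (simp add: indicator_def)
    qed
    also have "\<dots> = t n * \<delta>" using ind by simp
    finally show ?thesis .
  qed
  have FD: "\<bar>F n \<omega>\<bar> \<le> t n * D" for n \<omega>
    using diff[of n \<omega> 0 D] hD by simp
  have t0: "t \<longlonglongrightarrow> 0"
    unfolding t_def using LIMSEQ_inverse_real_of_nat by (simp add: inverse_eq_divide)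
  have lim: "(\<lambda>n. F n \<omega> / t n) \<longlonglongrightarrow> h 0" if \<omega>0: "path_at \<omega> 0 = 0" for \<omega>
  proof (rule LIMSEQ_I)
    fix r :: real assume "0 < r"
    then obtain \<delta> where \<delta>: "\<delta> > 0" "\<And>x. dist x 0 < \<delta> \<Longrightarrow> \<bar>h x - h 0\<bar> < r / 2"
      using hc unfolding continuous_at_eps_delta dist_real_def by (metis half_gt_zero)
    obtain d where d: "d > 0" "\<And>s. s \<in> {0..} \<Longrightarrow> dist s 0 < d \<Longrightarrow> dist (path_at \<omega> s) 0 < \<delta>"
      using path_at_continuous[of \<omega>] \<delta>(1) \<omega>0 unfolding continuous_on_iff
      by (metis atLeast_iff order_refl)
    obtain N where N: "\<And>n. N \<le> n \<Longrightarrow> t n < d"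
      using LIMSEQ_D[OF t0 d(1)] t by (auto simp: less_imp_le)
    have "norm (F n \<omega> / t n - h 0) < r" if "N \<le> n" for n
    proof -
      have "\<bar>F n \<omega> - t n * h 0\<bar> \<le> t n * (r / 2)"
      proof (rule diff)
        fix s assume "s \<in> {0..t n}"
        then have "dist (path_at \<omega> s) 0 < \<delta>" using d(2)[of s] N[OF that] by auto
        then show "\<bar>h (path_at \<omega> s) - h 0\<bar> \<le> r / 2" using \<delta>(2) by (simp add: less_imp_le)
      qed
      also have "\<dots> < t n * r" using t[of n] \<open>0 < r\<close> by simp
      finally have "\<bar>F n \<omega> - t n * h 0\<bar> / t n < r" using t[of n] by (simp add: divide_less_eq mult.commute)
      moreover have "F n \<omega> / t n - h 0 = (F n \<omega> - t n * h 0) / t n" using t[of n] by (simp add: field_simps)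
      ultimately show ?thesis using t[of n] by (simp add: abs_divide)
    qed
    then show "\<exists>N. \<forall>n\<ge>N. norm (F n \<omega> / t n - h 0) < r" by blast
  qed
  \<comment> \<open>A quadratic error is enough: the argument is of order \<open>t n\<close>, so
    after division by \<open>t n\<close> the error still tends to 0.\<close>
  have sin_small: "\<bar>sin x - x\<bar> \<le> x\<^sup>2" for x :: real
  proof -
    have "\<bar>sin x - x\<bar> \<le> x\<^sup>2 / 2"
      using Maclaurin_sin_bound[of x 2] by (simp add: numeral_2_eq_2 sin_coeff_def)
    then show ?thesis using zero_le_power2[of x] by linarith
  qed
  have "(\<lambda>n. \<integral>\<omega>. sin (\<gamma> * F n \<omega>) / t n \<partial>W) \<longlonglongrightarrow> (\<integral>\<omega>. \<gamma> * h 0 \<partial>W)"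
  proof (rule integral_dominated_convergence[where w = "\<lambda>_. \<bar>\<gamma>\<bar> * D"])
    show "(\<lambda>\<omega>. sin (\<gamma> * F n \<omega>) / t n) \<in> borel_measurable W" for n
      unfolding F_def using t[of n]
      by (intro borel_measurable_divide borel_measurable_const sin_noise_mass(1)
          window_square_integrable g) auto
    have "AE \<omega> in W. path_at \<omega> 0 = 0" using W by (simp add: wiener_measure_def)
    then show "AE \<omega> in W. (\<lambda>n. sin (\<gamma> * F n \<omega>) / t n) \<longlonglongrightarrow> \<gamma> * h 0"
    proof eventually_elim
      case (elim \<omega>)
      have *: "(\<lambda>n. \<gamma> * (F n \<omega> / t n)) \<longlonglongrightarrow> \<gamma> * h 0"
        by (intro tendsto_mult tendsto_const lim elim)
      have "(\<lambda>n. sin (\<gamma> * F n \<omega>) / t n - \<gamma> * (F n \<omega> / t n)) \<longlonglongrightarrow> 0"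
      proof (rule Lim_null_comparison)
        show "\<forall>\<^sub>F n in sequentially. norm (sin (\<gamma> * F n \<omega>) / t n - \<gamma> * (F n \<omega> / t n)) \<le> \<gamma>\<^sup>2 * D\<^sup>2 * t n"
        proof (rule always_eventually, rule allI)
          fix n
          have "\<bar>F n \<omega>\<bar>\<^sup>2 \<le> (t n * D)\<^sup>2" by (rule power_mono[OF FD]) simp
          then have "(\<gamma> * F n \<omega>)\<^sup>2 \<le> \<gamma>\<^sup>2 * (t n * D)\<^sup>2"
            unfolding power_mult_distrib[of \<gamma>] by (intro mult_left_mono) auto
          with sin_small[of "\<gamma> * F n \<omega>"]
          have "\<bar>sin (\<gamma> * F n \<omega>) - \<gamma> * F n \<omega>\<bar> \<le> \<gamma>\<^sup>2 * (t n * D)\<^sup>2" by linarith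
          then have "\<bar>sin (\<gamma> * F n \<omega>) - \<gamma> * F n \<omega>\<bar> / t n \<le> \<gamma>\<^sup>2 * (t n * D)\<^sup>2 / t n"
            using t[of n] by (intro divide_right_mono) auto
          also have "\<gamma>\<^sup>2 * (t n * D)\<^sup>2 / t n = \<gamma>\<^sup>2 * D\<^sup>2 * t n"
            using t[of n] by (simp add: power2_eq_square)
          finally show "norm (sin (\<gamma> * F n \<omega>) / t n - \<gamma> * (F n \<omega> / t n)) \<le> \<gamma>\<^sup>2 * D\<^sup>2 * t n"
            using t[of n] by (simp add: diff_divide_distrib[symmetric] abs_divide)
        qed
        show "(\<lambda>n. \<gamma>\<^sup>2 * D\<^sup>2 * t n) \<longlonglongrightarrow> 0" using tendsto_mult_right_zero[OF t0] by simp
      qed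
      from tendsto_add[OF this *] show ?case by simp
    qed
    show "AE \<omega> in W. norm (sin (\<gamma> * F n \<omega>) / t n) \<le> \<bar>\<gamma>\<bar> * D" for n
    proof (rule AE_I2)
      fix \<omega>
      have "\<bar>sin (\<gamma> * F n \<omega>)\<bar> \<le> \<bar>\<gamma>\<bar> * (t n * D)"
        using abs_sin_x_le_abs_x[of "\<gamma> * F n \<omega>"] mult_left_mono[OF FD[of n \<omega>], of "\<bar>\<gamma>\<bar>"]
        by (simp add: abs_mult)
      then show "norm (sin (\<gamma> * F n \<omega>) / t n) \<le> \<bar>\<gamma>\<bar> * D"
        using t[of n] by (simp add: abs_divide divide_le_eq mult_ac)
    qed
  qed auto
  moreover have "h 0 = (\<integral>y. g y * \<phi> y \<partial>lborel)"
    unfolding h_def by (simp add: mollifier_even[OF \<phi>])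
  ultimately show ?thesis by (simp add: F_def W.prob_space)
qed

end

section \<open>Separation of the two mollifiers\<close>

text \<open>The set where \<open>g\<close> does not vanish is null and, by continuity, open. A
  nonempty open set contains a nonempty open box, which is not negligible.\<close>

lemma continuous_integral_square_zero:
  fixes g :: "'a::euclidean_space \<Rightarrow> real"
  assumes "continuous_on UNIV g" "integrable lborel (\<lambda>x. (g x)\<^sup>2)" "(\<integral>x. (g x)\<^sup>2 \<partial>lborel) = 0"
  shows "g x = 0"
proof -
  have "AE x in lborel. (g x)\<^sup>2 = 0"
    using assms(2,3) by (subst (asm) integral_nonneg_eq_0_iff_AE) auto
  then have ae: "AE x in lborel. x \<notin> {x. g x \<noteq> 0}" by eventually_elim simp
  have op: "open {x. g x \<noteq> 0}"
    by (rule open_Collect_neq[OF assms(1) continuous_on_const])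
  then have "{x. g x \<noteq> 0} \<in> sets lborel" by simp
  from AE_iff_null_sets[THEN iffD2, OF this ae]
  have "{x. g x \<noteq> 0} \<in> null_sets lborel" .
  then have neg: "negligible {x. g x \<noteq> 0}"
    unfolding negligible_iff_null_sets by (rule null_sets_completionI)
  show ?thesis
  proof (rule ccontr)
    assume "g x \<noteq> 0"
    then have "x \<in> {x. g x \<noteq> 0}" by simp
    then obtain a b where sub: "box a b \<subseteq> {x. g x \<noteq> 0}" and x: "x \<in> box a b"
      and "\<forall>i\<in>Basis. a \<bullet> i < b \<bullet> i"
      by (rule open_contains_box[OF op])
    from negligible_subset[OF neg sub] have "box a b = {}"
      by (simp only: negligible_interval)
    with x show False by simp
  qed
qed

theorem proposition3p12:
  fixes M :: "'e measure"
    and W :: "(real ^ 'n) cpath measure"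
    and B :: "(real \<times> (real ^ 'n) \<Rightarrow> real) \<Rightarrow> 'e \<Rightarrow> real"
    and \<phi> \<phi>' :: "real ^ 'n \<Rightarrow> real"
    and H H' :: "real \<Rightarrow> (real ^ 'n) cpath \<Rightarrow> 'e \<Rightarrow> real"
    and \<mu> \<mu>' :: "'e \<Rightarrow> (real ^ 'n) cpath measure"
    and \<gamma> :: real
  assumes "CARD('n) \<ge> 3"
    and "prob_space M" and "complete_measure M"
    and "wiener_measure W"
    and "white_noise M B"
    and "mollifier \<phi>" and "mollifier \<phi>'"
    and "hamiltonian_version M B \<phi> H" and "hamiltonian_version M B \<phi>' H'"
    and "\<gamma> > 0"
    and "ereal \<gamma> < critical_parameter M W \<phi> H"
    and "ereal \<gamma> < critical_parameter M W \<phi>' H'"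
    and "gmc_limit M W \<phi> H \<gamma> \<mu>" and "gmc_limit M W \<phi>' H' \<gamma> \<mu>'"
    and "\<phi> \<noteq> \<phi>'"
  shows "\<not> (AE e in M. \<mu> e = \<mu>' e)"
proof
  assume eq: "AE e in M. \<mu> e = \<mu>' e"
  note M = assms(2) and W = assms(4) and B = assms(5) and \<phi> = assms(6) and \<phi>' = assms(7)
    and H = assms(8) and H' = assms(9)
  define g where "g x = \<phi> x - \<phi>' x" for x
  have [measurable]: "\<phi> \<in> borel_measurable borel" "\<phi>' \<in> borel_measurable borel"
    by (rule mollifier_measurable[OF \<phi>], rule mollifier_measurable[OF \<phi>'])
  have gm[measurable]: "g \<in> borel_measurable borel" unfolding g_def by measurable
  have gi: "integrable lborel g"
    unfolding g_def using mollifier_integrable[OF \<phi>] mollifier_integrable[OF \<phi>'] by simp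
  obtain C where "\<And>x. \<bar>\<phi> x\<bar> \<le> C" using mollifier_bounded[OF \<phi>] by blast
  moreover obtain C' where "\<And>x. \<bar>\<phi>' x\<bar> \<le> C'" using mollifier_bounded[OF \<phi>'] by blast
  ultimately have "\<bar>g x\<bar> \<le> C + C'" for x
    unfolding g_def by (meson abs_triangle_ineq4 add_mono order_trans)
  note ig = mollifier_integrable_mult[OF \<phi> gm this] mollifier_integrable_mult[OF \<phi>' gm this]
  \<comment> \<open>This form makes the two limits below,
    \<open>\<integral>y. g y * \<phi> y \<partial>lborel\<close> and its counterpart for
    \<open>\<phi>'\<close>, differ by exactly the squared norm of \<open>g\<close>.\<close>
  have g2: "(\<lambda>x. (g x)\<^sup>2) = (\<lambda>x. \<phi> x * g x - \<phi>' x * g x)"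
    by (auto simp: g_def power2_eq_square algebra_simps)
  have gs: "integrable lborel (\<lambda>x. (g x)\<^sup>2)"
    unfolding g2 using ig by simp
  define t where "t n = 1 / real (Suc n)" for n
  have t: "0 \<le> t n" for n by (simp add: t_def)
  have noise: "B (window (t n) g) \<in> borel_measurable M" for n
    using white_noise_gaussian[OF B window_square_integrable[OF gm gs t]] by (simp add: centered_gaussian_def)
  have mass: "(\<lambda>e. measure (\<nu> e) UNIV) \<in> borel_measurable M" if "random_measure M \<nu>"
    for \<nu> :: "'e \<Rightarrow> (real ^ 'n) cpath measure"
    using that unfolding random_measure_def measure_def by (auto intro!: borel_measurable_enn2real)
  have rm: "random_measure M \<mu>" "random_measure M \<mu>'"
    using assms(13,14) unfolding gmc_limit_def by blast+
  have "(\<integral>e. sin (B (window (t n) g) e) * measure (\<mu> e) UNIV \<partial>M)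
    = (\<integral>e. sin (B (window (t n) g) e) * measure (\<mu>' e) UNIV \<partial>M)" for n
  proof (rule integral_cong_AE)
    show "AE e in M. sin (B (window (t n) g) e) * measure (\<mu> e) UNIV
      = sin (B (window (t n) g) e) * measure (\<mu>' e) UNIV"
      using eq by eventually_elim simp
  qed (use noise[of n] mass[OF rm(1)] mass[OF rm(2)] in measurable)
  \<comment> \<open>The exponential prefactor depends on the window alone, so it is the same
    positive number on both sides and cancels.\<close>
  then have same: "(\<integral>\<omega>. sin (\<gamma> * (\<integral>z. window (t n) g z * path_kernel \<phi> (t n) \<omega> z \<partial>spacetime)) \<partial>W)
    = (\<integral>\<omega>. sin (\<gamma> * (\<integral>z. window (t n) g z * path_kernel \<phi>' (t n) \<omega> z \<partial>spacetime)) \<partial>W)" for n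
    using sin_noise_limit_mass[OF M W B \<phi> H assms(10,11,13) gm gi gs t[of n]]
      sin_noise_limit_mass[OF M W B \<phi>' H' assms(10,12,14) gm gi gs t[of n]] by simp
  \<comment> \<open>The quotients by \<open>t n\<close> agree for the two mollifiers, so their
    limits agree.\<close>
  have "\<gamma> * (\<integral>y. g y * \<phi> y \<partial>lborel) = \<gamma> * (\<integral>y. g y * \<phi>' y \<partial>lborel)"
    using sin_window_small_time[OF M W B \<phi> H gm gi gs, of \<gamma>]
      sin_window_small_time[OF M W B \<phi>' H' gm gi gs, of \<gamma>]
    unfolding t_def[symmetric] same by (rule LIMSEQ_unique)
  then have zero: "(\<integral>x. (g x)\<^sup>2 \<partial>lborel) = 0"
    unfolding g2 using ig assms(10) by (simp add: mult.commute)
  have cont: "continuous_on UNIV g"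
    unfolding g_def by (intro continuous_on_diff mollifier_continuous \<phi> \<phi>')
  have "g x = 0" for x by (rule continuous_integral_square_zero[OF cont gs zero])
  then have "\<phi> = \<phi>'" by (simp add: g_def fun_eq_iff)
  with assms(15) show False by simp
qed

end
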